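(* Let $\rho_1,\rho_2$ be two increasing sequences in $[0,1)$ tending to $1$ and let $w_1\neq w_2$ in $\mathbb{D}$. Then $$\mathcal{U}_A^{w_1}(\mathbb{D})\setminus\mathcal{U}_A^{w_2}(\mathbb{D})\neq\emptyset\quad\text{and}\quad\mathcal{U}_A^{w_1}(\mathbb{D},\rho_1)\setminus\mathcal{U}_A^{w_2}(\mathbb{D},\rho_2)\neq\emptyset.$$
   Context: $\mathbb{D}$ is the open unit disc, $\mathbb{T}=\partial\mathbb{D}$ the unit circle, and $H(\mathbb{D})$ the space of holomorphic functions on $\mathbb{D}$. For $w\in\mathbb{D}$ and an increasing sequence $\rho=(r_n)_n$ in $[0,1)$ with $r_n\to1$, $\mathcal{U}_A^w(\mathbb{D},\rho)$ (the $w$-Abel universal functions) denotes the set of all $f\in H(\mathbb{D})$ such that: for any compact subset $K\subset\mathbb{T}$, $K\neq\mathbb{T}$, and any continuous function $\varphi:K\to\mathbb{C}$, there exists an increasing sequence $(n_k)_k$ in $\mathbb{N}$ such that $\sup_{\zeta\in K}|f(w+r_{n_k}(\zeta-w))-\varphi(\zeta)|\to0$ as $k\to\infty$. Moreover $\mathcal{U}_A^w(\mathbb{D})=\bigcup_\rho\mathcal{U}_A^w(\mathbb{D},\rho)$, where $\rho$ varies over all increasing sequences in $[0,1)$ tending to $1$. *)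

theory Defs
  imports "HOL-Complex_Analysis.Complex_Analysis"
begin

(* "Increasing" is read in the weak sense for the radii; this includes the strictly increasing
   sequences.  The subsequence of indices below is strictly increasing. *)
definition radius_seq :: "(nat \<Rightarrow> real) \<Rightarrow> bool" where
  "radius_seq r \<longleftrightarrow> (\<forall>n. 0 \<le> r n \<and> r n < 1) \<and> incseq r \<and> r \<longlonglongrightarrow> 1"

(* Members are total functions holomorphic on the open unit disc.  For w in the disc and a radius
   sequence r, only their values on the disc matter, since all the points w + r n (\<zeta> - w) with
   \<zeta> on the unit circle lie in the disc. *)
definition abel_universal_wrt :: "complex \<Rightarrow> (nat \<Rightarrow> real) \<Rightarrow> (complex \<Rightarrow> complex) set" where
  "abel_universal_wrt w r =
     {f. f holomorphic_on ball 0 1 \<and>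
         (\<forall>K \<phi>. compact K \<and> K \<subseteq> sphere 0 1 \<and> K \<noteq> sphere 0 1 \<and> continuous_on K \<phi> \<longrightarrow>
            (\<exists>n :: nat \<Rightarrow> nat. strict_mono n \<and>
               uniform_limit K (\<lambda>k \<zeta>. f (w + of_real (r (n k)) * (\<zeta> - w))) \<phi> sequentially))}"

definition abel_universal :: "complex \<Rightarrow> (complex \<Rightarrow> complex) set" where
  "abel_universal w = (\<Union>r \<in> Collect radius_seq. abel_universal_wrt w r)"

end

theory Submission
  imports Defs "HOL-Computational_Algebra.Fundamental_Theorem_Algebra"
begin

text \<open>
  A single function \<open>f\<close>, universal for \<open>w\<^sub>1\<close> along \<open>\<rho>\<^sub>1\<close> but not for \<open>w\<^sub>2\<close> along any radius sequence,
  gives both claims. Let \<open>u\<close> be the direction of \<open>w\<^sub>1 - w\<^sub>2\<close> and pass to a sparse subsequence \<open>\<sigma>\<close>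
  of \<open>\<rho>\<^sub>1\<close>. By polynomial approximation, \<open>f\<close> is built so that it realises a dense sequence of targets
  on large arcs of the circles \<open>w\<^sub>1 + \<sigma> n (\<zeta> - w\<^sub>1)\<close>, while \<open>\<bar>f\<bar> \<le> 1\<close> on the two segments from \<open>w\<^sub>1\<close> to \<open>u\<close>
  and to \<open>-u\<close>, except for small gaps around the radii \<open>\<sigma> n\<close>. A circle \<open>w\<^sub>2 + (1 - k) (\<zeta> - w\<^sub>2)\<close> with \<open>k\<close>
  small meets these segments at radii \<open>1 - x\<close> and \<open>1 - y\<close>, where \<open>x / k\<close> is close to a constant above
  \<open>1\<close> and \<open>y / k\<close> to a constant below \<open>1\<close>. Hence the two points cannot both lie in gaps, and \<open>f\<close>
  is bounded by \<open>1\<close> near \<open>u\<close> or \<open>-u\<close> on every such circle, so \<open>f\<close> cannot approximate the constant \<open>3\<close> there.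
\<close>

section \<open>Uniform approximation by polynomials\<close>

text \<open>On a compact \<open>S\<close> this is membership of the restriction of \<open>f\<close>
  in the uniform closure of the polynomials; only the values of \<open>f\<close> on \<open>S\<close>
  matter.\<close>

definition poly_approximable :: "complex set \<Rightarrow> (complex \<Rightarrow> complex) \<Rightarrow> bool" where
  "poly_approximable S f \<longleftrightarrow> (\<forall>e>0. \<exists>p. \<forall>z\<in>S. norm (f z - poly p z) < e)"

lemma poly_approximableD:
  assumes "poly_approximable S f" "e > 0"
  obtains p where "\<And>z. z \<in> S \<Longrightarrow> norm (f z - poly p z) < e"
  using assms unfolding poly_approximable_def by metis

lemma poly_approximable_poly [intro, simp]: "poly_approximable S (poly p)"
  unfolding poly_approximable_def by (intro allI impI exI[of _ p]) simp

lemma poly_approximable_transfer: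
  "poly_approximable S f \<Longrightarrow> (\<And>z. z \<in> S \<Longrightarrow> f z = g z) \<Longrightarrow> poly_approximable S g"
  unfolding poly_approximable_def by simp

lemma poly_approximable_const [intro, simp]: "poly_approximable S (\<lambda>_. c)"
  unfolding poly_approximable_def by (intro allI impI exI[of _ "[:c:]"]) simp

lemma poly_approximable_id [intro, simp]: "poly_approximable S (\<lambda>z. z)"
  unfolding poly_approximable_def by (intro allI impI exI[of _ "[:0, 1:]"]) simp

lemma poly_approximable_limit:
  assumes "\<And>e. e > 0 \<Longrightarrow> \<exists>g. poly_approximable S g \<and> (\<forall>z\<in>S. norm (f z - g z) < e)"
  shows "poly_approximable S f"
  unfolding poly_approximable_def
proof (intro allI impI)
  fix e :: real assume "e > 0"
  then obtain g where g: "poly_approximable S g" "\<And>z. z \<in> S \<Longrightarrow> norm (f z - g z) < e/2"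
    using assms[of "e/2"] by auto
  obtain p where p: "\<And>z. z \<in> S \<Longrightarrow> norm (g z - poly p z) < e/2"
    using poly_approximableD[OF g(1), of "e/2"] \<open>e > 0\<close> by auto
  have "norm (f z - poly p z) < e" if "z \<in> S" for z
    using norm_triangle_ineq[of "f z - g z" "g z - poly p z"] g(2)[OF that] p[OF that] by simp
  then show "\<exists>p. \<forall>z\<in>S. norm (f z - poly p z) < e" by blast
qed

lemma poly_approximable_add:
  assumes "poly_approximable S f" "poly_approximable S g"
  shows "poly_approximable S (\<lambda>z. f z + g z)"
  unfolding poly_approximable_def
proof (intro allI impI)
  fix e :: real assume "e > 0"
  obtain p where p: "\<And>z. z \<in> S \<Longrightarrow> norm (f z - poly p z) < e/2"
    using poly_approximableD[OF assms(1), of "e/2"] \<open>e > 0\<close> by auto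
  obtain q where q: "\<And>z. z \<in> S \<Longrightarrow> norm (g z - poly q z) < e/2"
    using poly_approximableD[OF assms(2), of "e/2"] \<open>e > 0\<close> by auto
  have "norm (f z + g z - poly (p + q) z) < e" if "z \<in> S" for z
    using norm_triangle_ineq[of "f z - poly p z" "g z - poly q z"] p[OF that] q[OF that]
    by (simp add: algebra_simps)
  then show "\<exists>p. \<forall>z\<in>S. norm (f z + g z - poly p z) < e" by blast
qed

lemma poly_bounded_on:
  fixes S :: "complex set"
  assumes "bounded S"
  obtains M where "M > 0" "\<And>z. z \<in> S \<Longrightarrow> norm (poly p z) \<le> M"
proof -
  have "compact (closure S)" using assms by simp
  then have "bounded (poly p ` closure S)"
    by (intro compact_imp_bounded compact_continuous_image continuous_intros)
  then show thesis
    using that closure_subset[of S] by (auto simp: bounded_pos)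
qed

lemma poly_approximable_bounded:
  assumes "poly_approximable S f" "bounded S"
  obtains M where "M > 0" "\<And>z. z \<in> S \<Longrightarrow> norm (f z) \<le> M"
proof -
  obtain p where p: "\<And>z. z \<in> S \<Longrightarrow> norm (f z - poly p z) < 1"
    using poly_approximableD[OF assms(1), of 1] by auto
  obtain M where M: "M > 0" "\<And>z. z \<in> S \<Longrightarrow> norm (poly p z) \<le> M"
    using poly_bounded_on[OF assms(2)] by blast
  have "norm (f z) \<le> M + 1" if "z \<in> S" for z
    using norm_triangle_ineq[of "f z - poly p z" "poly p z"] p[OF that] M(2)[OF that] by simp
  with M(1) show thesis by (intro that[of "M+1"]) auto
qed

lemma poly_approximable_mult:
  assumes "poly_approximable S f" "poly_approximable S g" "bounded S"
  shows "poly_approximable S (\<lambda>z. f z * g z)"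
  unfolding poly_approximable_def
proof (intro allI impI)
  fix e :: real assume e: "e > 0"
  obtain M where M: "M > 0" "\<And>z. z \<in> S \<Longrightarrow> norm (f z) \<le> M"
    using poly_approximable_bounded[OF assms(1,3)] by blast
  obtain q where q: "\<And>z. z \<in> S \<Longrightarrow> norm (g z - poly q z) < e/2/M"
    using poly_approximableD[OF assms(2), of "e/2/M"] e M(1) by auto
  \<comment> \<open>\<open>L\<close> bounds the polynomial \<open>q\<close> already chosen, so
    \<open>p\<close> has to come last, with an accuracy relative to \<open>L\<close>.\<close>
  obtain L where L: "L > 0" "\<And>z. z \<in> S \<Longrightarrow> norm (poly q z) \<le> L"
    using poly_bounded_on[OF assms(3)] by blast
  obtain p where p: "\<And>z. z \<in> S \<Longrightarrow> norm (f z - poly p z) < e/2/L"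
    using poly_approximableD[OF assms(1), of "e/2/L"] e L(1) by auto
  have "norm (f z * g z - poly (p * q) z) < e" if z: "z \<in> S" for z
  proof -
    have "f z * g z - poly (p * q) z = f z * (g z - poly q z) + (f z - poly p z) * poly q z"
      by (simp add: algebra_simps)
    also have "norm \<dots> \<le> norm (f z) * norm (g z - poly q z) + norm (f z - poly p z) * norm (poly q z)"
      by (metis norm_triangle_ineq norm_mult)
    also have "\<dots> \<le> M * norm (g z - poly q z) + norm (f z - poly p z) * L"
      by (intro add_mono mult_right_mono mult_left_mono M L z) auto
    also have "\<dots> < M * (e/2/M) + (e/2/L) * L"
      using q[OF z] p[OF z] M(1) L(1) by (intro add_strict_mono mult_strict_left_mono mult_strict_right_mono)
    also have "\<dots> = e" using M(1) L(1) by simp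
    finally show ?thesis .
  qed
  then show "\<exists>p. \<forall>z\<in>S. norm (f z * g z - poly p z) < e" by blast
qed

lemma poly_approximable_diff:
  assumes "poly_approximable S f" "poly_approximable S g" "bounded S"
  shows "poly_approximable S (\<lambda>z. f z - g z)"
  using poly_approximable_add[OF assms(1)
      poly_approximable_mult[OF poly_approximable_const[of S "-1"] assms(2,3)]] by simp

lemma poly_approximable_power:
  assumes "poly_approximable S f" "bounded S"
  shows "poly_approximable S (\<lambda>z. f z ^ n)"
  by (induction n) (auto intro: poly_approximable_mult assms)

lemma poly_approximable_sum:
  assumes "\<And>i. i \<in> I \<Longrightarrow> poly_approximable S (f i)"
  shows "poly_approximable S (\<lambda>z. \<Sum>i\<in>I. f i z)"
  using assms by (induction I rule: infinite_finite_induct) (auto intro: poly_approximable_add)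

section \<open>Geometric series and reciprocals of polynomials\<close>

text \<open>The partial sums of the geometric series in \<open>g z\<close> have error at most
  \<open>c ^ n / (1 - c)\<close>, uniformly on \<open>S\<close>.\<close>

lemma poly_approximable_geometric:
  assumes g: "poly_approximable S g" and S: "bounded S" and c: "c < 1"
    and le: "\<And>z. z \<in> S \<Longrightarrow> norm (g z) \<le> c"
  shows "poly_approximable S (\<lambda>z. 1 / (1 - g z))"
proof (cases "S = {}")
  case True
  then show ?thesis by (simp add: poly_approximable_def)
next
  case False
  with le have c0: "c \<ge> 0" by (meson all_not_in_conv norm_ge_zero order_trans)
  show ?thesis
  proof (rule poly_approximable_limit)
    fix e :: real assume e: "e > 0"
    have "(\<lambda>n. c ^ n / (1 - c)) \<longlonglongrightarrow> 0"
      using c c0 by (intro tendsto_divide_zero LIMSEQ_realpow_zero)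
    then obtain n where n: "c ^ n / (1 - c) < e"
      using e by (metis (no_types, lifting) eventually_at_top_linorder order_refl order_tendstoD(2))
    have "norm (1 / (1 - g z) - (\<Sum>i<n. g z ^ i)) < e" if z: "z \<in> S" for z
    proof -
      have ne: "norm (1 - g z) \<ge> 1 - c"
        using norm_triangle_ineq2[of 1 "g z"] le[OF z] by simp
      then have nz: "1 - g z \<noteq> 0" using c by auto
      have "1 / (1 - g z) - (\<Sum>i<n. g z ^ i) = g z ^ n / (1 - g z)"
        using nz by (simp add: sum_gp_strict divide_simps)
      also have "norm \<dots> \<le> c ^ n / (1 - c)"
        unfolding norm_divide norm_power
        using c c0 ne le[OF z] by (intro frac_le power_mono) auto
      finally show ?thesis using n by simp
    qed
    moreover have "poly_approximable S (\<lambda>z. \<Sum>i<n. g z ^ i)"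
      by (intro poly_approximable_sum poly_approximable_power g S)
    ultimately show "\<exists>h. poly_approximable S h \<and> (\<forall>z\<in>S. norm (1 / (1 - g z) - h z) < e)"
      by blast
  qed
qed

text \<open>Pole pushing: the good poles form a nonempty clopen subset of the complement.\<close>

lemma poly_approximable_inverse_linear:
  assumes S: "compact S" and con: "connected (- S)" and a: "a \<notin> S"
  shows "poly_approximable S (\<lambda>z. 1 / (z - a))"
proof (cases "S = {}")
  case True
  then show ?thesis by (simp add: poly_approximable_def)
next
  case ne: False
  have bdd: "bounded S" using S by (rule compact_imp_bounded)
  define G where "G = {p. p \<notin> S \<and> poly_approximable S (\<lambda>z. 1 / (z - p))}"
  \<comment> \<open>The identity
    \<open>1 / (z - q) = 1 / (z - p) * (1 / (1 - (q - p) / (z - p)))\<close> moves the pole from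
    \<open>p\<close> to \<open>q\<close>; on \<open>S\<close> the geometric ratio is at most
    1/2.\<close>
  have push: "q \<in> G" if p: "p \<in> G" and "2 * dist q p < infdist p S" for p q
  proof -
    define d where "d = infdist p S"
    have far: "norm (z - p) \<ge> d" if "z \<in> S" for z
      using infdist_le[OF that, of p] by (simp add: d_def dist_norm norm_minus_commute)
    have d: "2 * norm (q - p) < d" using that(2) by (simp add: d_def dist_norm)
    then have d0: "d > 0" using norm_ge_zero[of "q - p"] by linarith
    have "q \<notin> S" using far[of q] d norm_ge_zero[of "q - p"] by linarith
    have P: "poly_approximable S (\<lambda>z. 1 / (z - p))" using p by (simp add: G_def)
    have "poly_approximable S (\<lambda>z. 1 / (1 - (q - p) * (1 / (z - p))))"
    proof (rule poly_approximable_geometric[where c = "1/2"])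
      show "norm ((q - p) * (1 / (z - p))) \<le> 1/2" if "z \<in> S" for z
        using far[OF that] d d0 by (simp add: norm_divide divide_simps)
    qed (auto intro: poly_approximable_mult[OF poly_approximable_const P bdd] bdd
          simp del: times_divide_eq_right)
    then have "poly_approximable S (\<lambda>z. 1 / (z - p) * (1 / (1 - (q - p) * (1 / (z - p)))))"
      by (intro poly_approximable_mult P bdd)
    moreover have "1 / (z - p) * (1 / (1 - (q - p) * (1 / (z - p)))) = 1 / (z - q)" if "z \<in> S" for z
    proof -
      have "z \<noteq> p" using far[OF that] d0 by auto
      then show ?thesis by (simp add: field_simps)
    qed
    ultimately have "poly_approximable S (\<lambda>z. 1 / (z - q))"
      by (rule poly_approximable_transfer)
    then show ?thesis
      using \<open>q \<notin> S\<close> by (simp add: G_def)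
  qed
  have pos: "infdist p S > 0" if "p \<notin> S" for p
    using that S ne by (metis compact_imp_closed in_closed_iff_infdist_zero infdist_nonneg less_eq_real_def)
  have "open G"
    unfolding open_dist
  proof
    fix p assume p: "p \<in> G"
    then have "infdist p S > 0" using pos by (auto simp: G_def)
    then show "\<exists>e>0. \<forall>y. dist y p < e \<longrightarrow> y \<in> G"
      using push[OF p] by (intro exI[of _ "infdist p S / 2"]) auto
  qed
  \<comment> \<open>A good pole \<open>y\<close> within a third of the distance from
    \<open>q\<close> to \<open>S\<close> could be pushed back to \<open>q\<close>, so points near a
    bad pole are bad.\<close>
  moreover have "open (- S - G)"
    unfolding open_dist
  proof
    fix q assume q: "q \<in> - S - G"
    then have pq: "infdist q S > 0" using pos by auto
    have "y \<in> - S - G" if "dist y q < infdist q S / 3" for y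
    proof -
      have tri: "infdist q S \<le> infdist y S + dist q y" by (rule infdist_triangle)
      have "y \<notin> S" using tri that pq by (auto simp: dist_commute)
      moreover have "y \<notin> G" using push[of y q] tri that q pq by (auto simp: dist_commute)
      ultimately show ?thesis by blast
    qed
    then show "\<exists>e>0. \<forall>y. dist y q < e \<longrightarrow> y \<in> - S - G"
      using pq by (intro exI[of _ "infdist q S / 3"]) auto
  qed
  \<comment> \<open>A pole of modulus \<open>2 * M\<close>, where \<open>M\<close> bounds
    \<open>S\<close>, is good: \<open>1 / (1 - z / p)\<close> has a geometric expansion of ratio at
    most 1/2 on \<open>S\<close>.\<close>
  moreover have "G \<noteq> {}"
  proof -
    obtain M where M: "M > 0" "\<And>z. z \<in> S \<Longrightarrow> norm z \<le> M" using bdd by (auto simp: bounded_pos)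
    define p where "p = complex_of_real (2 * M)"
    have np: "norm p = 2 * M" using M(1) by (simp add: p_def)
    have pS: "p \<notin> S" using M(2)[of p] M(1) np by auto
    have "poly_approximable S (\<lambda>z. 1 / (1 - (1/p) * z))"
    proof (rule poly_approximable_geometric[where c = "1/2"])
      show "poly_approximable S (\<lambda>z. (1/p) * z)"
        by (intro poly_approximable_mult bdd) auto
    qed (use M np bdd in \<open>auto simp: norm_divide divide_simps\<close>)
    then have "poly_approximable S (\<lambda>z. (- 1/p) * (1 / (1 - (1/p) * z)))"
      by (intro poly_approximable_mult bdd) auto
    moreover have "(- 1/p) * (1 / (1 - (1/p) * z)) = 1 / (z - p)" if "z \<in> S" for z
    proof -
      have "p \<noteq> 0" "z \<noteq> p" using np M(1) pS that by auto
      then show ?thesis by (simp add: divide_simps)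
    qed
    ultimately have "poly_approximable S (\<lambda>z. 1 / (z - p))"
      by (rule poly_approximable_transfer)
    then show ?thesis using pS by (auto simp: G_def)
  qed
  moreover have "G \<subseteq> - S" by (auto simp: G_def)
  ultimately have "- S - G = {}"
    using connectedD[OF con, of G "- S - G"] by blast
  with a show ?thesis by (auto simp: G_def)
qed

text \<open>The fundamental theorem of algebra splits off one factor \<open>1 / (z - r)\<close> at a
  time, and every zero \<open>r\<close> lies outside \<open>S\<close>, where poles are
  harmless.\<close>

lemma poly_approximable_inverse_poly:
  assumes S: "compact S" "connected (- S)" and nz: "\<And>z. z \<in> S \<Longrightarrow> poly p z \<noteq> 0"
  shows "poly_approximable S (\<lambda>z. 1 / poly p z)"
  using nz
proof (induction "degree p" arbitrary: p)
  case 0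
  then obtain c where "p = [:c:]" by (metis degree_eq_zeroE)
  then show ?case by simp
next
  case (Suc n)
  then have "\<not> constant (poly p)" by (simp add: constant_degree)
  then obtain r where r: "poly p r = 0" using fundamental_theorem_of_algebra by blast
  then obtain q where q: "p = [:-r, 1:] * q" by (metis dvdE poly_eq_0_iff_dvd)
  have "q \<noteq> 0" using Suc.hyps(2) q by auto
  then have "degree p = Suc (degree q)" unfolding q by (subst degree_mult_eq) auto
  then have "poly_approximable S (\<lambda>z. 1 / poly q z)"
    using Suc q by (intro Suc.hyps(1)) auto
  then have "poly_approximable S (\<lambda>z. 1 / (z - r) * (1 / poly q z))"
    using S r Suc.prems
    by (intro poly_approximable_mult poly_approximable_inverse_linear) (auto intro: compact_imp_bounded)
  then show ?case by (simp add: q left_diff_distrib)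
qed

text \<open>The functions \<open>1 / (1 - ((z - c) / R)^N)\<close> converge to the characteristic function of the
  disc, and all their poles lie on its boundary circle.\<close>

lemma poly_approximable_indicator_ball:
  assumes S: "compact S" "connected (- S)" and R: "R > 0" and dis: "S \<inter> sphere c R = {}"
  shows "poly_approximable S (\<lambda>z. if z \<in> ball c R then 1 else 0)"
proof (rule poly_approximable_limit)
  fix e :: real assume e: "e > 0"
  define v where "v = (\<lambda>z. (z - c) / of_real R)"
  have v: "norm (v z) = dist c z / R" for z
    using R by (simp add: v_def norm_divide dist_norm norm_minus_commute)
  have vne: "norm (v z) \<noteq> 1" if "z \<in> S" for z
    using dis that R by (auto simp: v)
  have cv: "continuous_on A v" for A unfolding v_def using R by (intro continuous_intros) auto
  \<comment> \<open>Since \<open>S\<close> misses the circle, its part inside the disc is compact,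
    and the maximum \<open>a\<close> of \<open>norm (v z)\<close> there is below 1; 0 serves if that
    part is empty.\<close>
  obtain a where a: "0 \<le> a" "a < 1" "\<And>z. z \<in> S \<Longrightarrow> norm (v z) < 1 \<Longrightarrow> norm (v z) \<le> a"
  proof (cases "S \<inter> ball c R = {}")
    case True
    then show thesis using R by (intro that[of 0]) (auto simp: v)
  next
    case False
    have "S \<inter> ball c R = S \<inter> cball c R" using dis by force
    then have "compact (S \<inter> ball c R)" using S(1) by (simp add: compact_Int_closed)
    then obtain x where x: "x \<in> S \<inter> ball c R" "\<And>y. y \<in> S \<inter> ball c R \<Longrightarrow> norm (v y) \<le> norm (v x)"
      using continuous_attains_sup[of "S \<inter> ball c R" "\<lambda>z. norm (v z)"] False
        continuous_on_norm[OF cv] by blast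
    show thesis using x R by (intro that[of "norm (v x)"]) (auto simp: v)
  qed
  \<comment> \<open>Likewise \<open>b\<close> is the minimum of \<open>norm (v z)\<close> on the
    part of \<open>S\<close> outside the disc; 2 serves if that part is empty.\<close>
  obtain b where b: "b > 1" "\<And>z. z \<in> S \<Longrightarrow> norm (v z) > 1 \<Longrightarrow> norm (v z) \<ge> b"
  proof (cases "S - ball c R = {}")
    case True
    then show thesis using R by (intro that[of 2]) (force simp: v)+
  next
    case False
    have "compact (S - ball c R)" using S(1) by (simp add: compact_diff)
    then obtain x where x: "x \<in> S - ball c R" "\<And>y. y \<in> S - ball c R \<Longrightarrow> norm (v x) \<le> norm (v y)"
      using continuous_attains_inf[of "S - ball c R" "\<lambda>z. norm (v z)"] False
        continuous_on_norm[OF cv] by blast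
    show thesis using x R vne[of x] by (intro that[of "norm (v x)"]) (auto simp: v)
  qed
  \<comment> \<open>The error of \<open>1 / (1 - v z ^ N)\<close> is at most
    \<open>a ^ N / (1 - a ^ N)\<close> inside the disc and at most \<open>1 / (b ^ N - 1)\<close>
    outside.\<close>
  have "(\<lambda>N. a ^ N / (1 - a ^ N)) \<longlonglongrightarrow> 0 / (1 - 0)"
    using a by (intro tendsto_intros LIMSEQ_realpow_zero) auto
  then have "\<forall>\<^sub>F N in sequentially. a ^ N / (1 - a ^ N) < e"
    using e by (intro order_tendstoD(2)) auto
  moreover have "(\<lambda>N. 1 / (b ^ N - 1)) \<longlonglongrightarrow> 0"
  proof -
    have "filterlim (\<lambda>N. - 1 + b ^ N) at_infinity sequentially"
      using b by (intro tendsto_add_filterlim_at_infinity[OF tendsto_const]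
          filterlim_realpow_sequentially_gt1) auto
    then have "((\<lambda>N. inverse (- 1 + b ^ N)) \<longlongrightarrow> 0) sequentially"
      by (rule filterlim_compose[OF tendsto_inverse_0])
    then show ?thesis by (simp add: divide_inverse)
  qed
  then have "\<forall>\<^sub>F N in sequentially. 1 / (b ^ N - 1) < e"
    using e by (rule order_tendstoD(2))
  ultimately have "\<forall>\<^sub>F N in sequentially. a ^ N / (1 - a ^ N) < e \<and> 1 / (b ^ N - 1) < e \<and> N > 0"
    by (intro eventually_conj eventually_gt_at_top)
  then obtain N where N: "a ^ N / (1 - a ^ N) < e" "1 / (b ^ N - 1) < e" "N > 0"
    by (auto simp: eventually_at_top_linorder)
  define P where "P = 1 - [: - c / of_real R, 1 / of_real R :] ^ N"
  have P: "poly P z = 1 - v z ^ N" for z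
    using R by (simp add: P_def v_def diff_divide_distrib)
  have vN: "v z ^ N \<noteq> 1" if "z \<in> S" for z
  proof
    assume "v z ^ N = 1"
    then have "norm (v z) ^ N = 1" by (metis norm_one norm_power)
    then show False using N(3) vne[OF that] power_eq_imp_eq_base[of "norm (v z)" N 1] by simp
  qed
  have "norm ((if z \<in> ball c R then 1 else 0) - 1 / poly P z) < e" if z: "z \<in> S" for z
  proof (cases "norm (v z) < 1")
    case True
    then have "z \<in> ball c R" using R by (simp add: v)
    then have "(if z \<in> ball c R then 1 else 0) - 1 / poly P z = - (v z ^ N / (1 - v z ^ N))"
      using vN[OF z] by (simp add: P field_simps)
    also have "norm \<dots> = norm (v z) ^ N / norm (1 - v z ^ N)"
      by (simp add: norm_divide norm_power)
    also have "\<dots> \<le> a ^ N / (1 - a ^ N)"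
    proof (rule frac_le)
      show le: "norm (v z) ^ N \<le> a ^ N" using a z True by (intro power_mono) auto
      show "0 < 1 - a ^ N" using a N(3) by (simp add: power_less_one_iff)
      show "1 - a ^ N \<le> norm (1 - v z ^ N)"
        using norm_triangle_ineq2[of 1 "v z ^ N"] le by (simp add: norm_power)
    qed (use a in auto)
    finally show ?thesis using N(1) by simp
  next
    case False
    then have gt: "norm (v z) > 1" using vne[OF z] by simp
    then have "z \<notin> ball c R" using R by (simp add: v)
    then have "norm ((if z \<in> ball c R then 1 else 0) - 1 / poly P z) = 1 / norm (1 - v z ^ N)"
      by (simp add: P norm_divide)
    also have "\<dots> \<le> 1 / (b ^ N - 1)"
    proof (rule frac_le)
      show "0 < b ^ N - 1" using b N(3) by (simp add: one_less_power)
      have "b ^ N \<le> norm (v z) ^ N" using b gt z by (intro power_mono) auto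
      then show "b ^ N - 1 \<le> norm (1 - v z ^ N)"
        using norm_triangle_ineq3[of "v z ^ N" 1] by (simp add: norm_power norm_minus_commute)
    qed auto
    finally show ?thesis using N(2) by simp
  qed
  moreover have "poly_approximable S (\<lambda>z. 1 / poly P z)"
    using vN by (intro poly_approximable_inverse_poly S) (auto simp: P)
  ultimately show "\<exists>g. poly_approximable S g \<and> (\<forall>z\<in>S. norm ((if z \<in> ball c R then 1 else 0) - g z) < e)"
    by blast
qed

section \<open>Proper compact subsets of the circle\<close>

text \<open>The open disc and the exterior stay connected after adding the circle points outside
  \<open>K\<close>, which lie in their closures; the enlarged sets share such a point because
  \<open>K\<close> is proper.\<close>

lemma connected_Compl_proper_subset_circle:
  fixes K :: "complex set"
  assumes "K \<subset> sphere 0 1"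
  shows "connected (- K)"
proof -
  obtain p where p: "p \<in> sphere 0 1 - K" using assms by blast
  have "connected (ball 0 1 \<union> (sphere 0 1 - K))"
    by (rule connected_intermediate_closure[of "ball 0 1"]) auto
  moreover have "connected (- cball (0::complex) 1)"
    by (intro connected_complement_bounded_convex) auto
  then have "connected (- cball 0 1 \<union> (sphere 0 1 - K))"
    by (rule connected_intermediate_closure) (auto simp: closure_complement)
  ultimately have "connected ((ball 0 1 \<union> (sphere 0 1 - K)) \<union> (- cball 0 1 \<union> (sphere 0 1 - K)))"
    using p by (rule_tac connected_Un) auto
  moreover have "(ball 0 1 \<union> (sphere 0 1 - K)) \<union> (- cball 0 1 \<union> (sphere 0 1 - K)) = - K"
    using assms by auto
  ultimately show ?thesis by simp
qed

text \<open>On the circle the real and imaginary parts of \<open>z\<close> are combinations of \<open>z\<close> and \<open>1/z\<close>,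
  so the real-valued Stone-Weierstrass theorem applies.\<close>

lemma poly_approximable_circle:
  fixes K :: "complex set"
  assumes K: "compact K" "K \<subset> sphere 0 1" and \<phi>: "continuous_on K \<phi>"
  shows "poly_approximable K \<phi>"
proof -
  have bdd: "bounded K" using K(1) by (rule compact_imp_bounded)
  \<comment> \<open>\<open>R\<close> consists of the real functions that complex polynomials
    approximate. Membership of \<open>Re\<close> and \<open>Im\<close> makes this ring separate
    points.\<close>
  define R where "R = {g :: complex \<Rightarrow> real. continuous_on K g \<and> poly_approximable K (\<lambda>z. of_real (g z))}"
  \<comment> \<open>Properness of \<open>K\<close> enters here: it makes the complement connected,
    so that the pole 0 inside the circle is allowed.\<close>
  have inv: "poly_approximable K (\<lambda>z. 1 / (z - 0))"
    using K connected_Compl_proper_subset_circle by (intro poly_approximable_inverse_linear) auto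
  have cnj: "1 / (z - 0) = cnj z" if "z \<in> K" for z
    using that K(2) complex_div_cnj[of 1 z] by auto
  have inv': "poly_approximable K cnj"
    by (rule poly_approximable_transfer[OF inv cnj])
  have Re: "Re \<in> R"
  proof -
    have "poly_approximable K (\<lambda>z. (1/2) * (z + cnj z))"
      by (intro poly_approximable_mult poly_approximable_add bdd inv') auto
    then have "poly_approximable K (\<lambda>z. of_real (Re z))"
      by (rule poly_approximable_transfer) (simp add: complex_eq_iff)
    then show ?thesis by (auto simp: R_def intro!: continuous_intros)
  qed
  have Im: "Im \<in> R"
  proof -
    have "poly_approximable K (\<lambda>z. (-\<i>/2) * (z - cnj z))"
      by (intro poly_approximable_mult poly_approximable_diff bdd inv') auto
    then have "poly_approximable K (\<lambda>z. of_real (Im z))"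
      by (rule poly_approximable_transfer) (simp add: complex_eq_iff)
    then show ?thesis by (auto simp: R_def intro!: continuous_intros)
  qed
  interpret function_ring_on R K
  proof
    fix f g :: "complex \<Rightarrow> real" assume f: "f \<in> R" and g: "g \<in> R"
    show "(\<lambda>x. f x + g x) \<in> R"
      using f g by (auto simp: R_def intro!: continuous_intros poly_approximable_add)
    show "(\<lambda>x. f x * g x) \<in> R"
      using f g bdd by (auto simp: R_def intro!: continuous_intros poly_approximable_mult)
  next
    fix x y :: complex assume "x \<noteq> y"
    then have "Re x \<noteq> Re y \<or> Im x \<noteq> Im y" by (simp add: complex_eq_iff)
    then show "\<exists>f\<in>R. f x \<noteq> f y" using Re Im by blast
  qed (auto simp: R_def K)
  have real: "poly_approximable K (\<lambda>z. of_real (g z))" if g: "continuous_on K g" for g :: "complex \<Rightarrow> real"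
  proof (rule poly_approximable_limit)
    fix e :: real assume "e > 0"
    then obtain h where h: "h \<in> R" "\<And>x. x \<in> K \<Longrightarrow> \<bar>g x - h x\<bar> < e"
      using Stone_Weierstrass_basic[OF g] by blast
    have "norm (complex_of_real (g z) - of_real (h z)) < e" if "z \<in> K" for z
      using h(2)[OF that] by (metis norm_of_real of_real_diff)
    with h(1) show "\<exists>h. poly_approximable K h \<and> (\<forall>z\<in>K. norm (complex_of_real (g z) - h z) < e)"
      by (intro exI[of _ "\<lambda>z. of_real (h z)"]) (auto simp: R_def)
  qed
  have "poly_approximable K (\<lambda>z. of_real (Re (\<phi> z)) + \<i> * of_real (Im (\<phi> z)))"
    using \<phi> bdd
    by (intro poly_approximable_add poly_approximable_mult real continuous_intros) auto
  then show ?thesis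
    by (rule poly_approximable_transfer) (simp add: complex_eq_iff)
qed

section \<open>Discs and rays centred at an interior point\<close>

abbreviation radial_pt :: "complex \<Rightarrow> complex \<Rightarrow> real \<Rightarrow> complex" where
  "radial_pt w a t \<equiv> w + of_real t * (a - w)"

text \<open>The boundary of \<open>radial_disc w r\<close> is the circle of the points \<open>radial_pt w \<zeta> r\<close> with \<open>norm \<zeta> = 1\<close>.\<close>

abbreviation radial_disc :: "complex \<Rightarrow> real \<Rightarrow> complex set" where
  "radial_disc w r \<equiv> cball ((1 - of_real r) * w) r"

abbreviation radial_odisc :: "complex \<Rightarrow> real \<Rightarrow> complex set" where
  "radial_odisc w r \<equiv> ball ((1 - of_real r) * w) r"

text \<open>In this form the triangle inequality, with \<open>norm a = 1\<close> and
  \<open>norm w < 1\<close>, compares the distance with \<open>r\<close> and so decides on which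
  side of the circle the point lies.\<close>

lemma dist_radial_pt:
  "dist ((1 - of_real r) * w) (radial_pt w a t) = norm (of_real t * a + of_real (r - t) * w)"
  by (simp add: dist_norm norm_minus_commute algebra_simps)

lemma radial_pt_in_odisc:
  assumes "norm w < 1" "norm a = 1" "0 \<le> t" "t < r"
  shows "radial_pt w a t \<in> radial_odisc w r"
proof -
  have "norm (of_real t * a + of_real (r - t) * w) \<le> t + (r - t) * norm w"
    using norm_triangle_ineq[of "of_real t * a" "of_real (r - t) * w"] assms
    by (simp only: norm_mult norm_of_real)
  also have "\<dots> < t + (r - t) * 1"
    using assms by (intro add_strict_left_mono mult_strict_left_mono) auto
  finally show ?thesis unfolding mem_ball mem_cball dist_radial_pt by simp
qed

lemma radial_pt_notin_disc:
  assumes "norm w < 1" "norm a = 1" "0 \<le> r" "r < t"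
  shows "radial_pt w a t \<notin> radial_disc w r"
proof -
  have "r = t - (t - r) * 1" by simp
  also have "\<dots> < t - (t - r) * norm w"
    using assms by (intro diff_strict_left_mono mult_strict_left_mono) auto
  also have "\<dots> \<le> norm (of_real t * a + of_real (r - t) * w)"
    using norm_diff_ineq[of "of_real t * a" "of_real (r - t) * w"] assms
    by (simp only: norm_mult norm_of_real) simp
  finally show ?thesis unfolding mem_ball mem_cball dist_radial_pt by simp
qed

lemma radial_pt_in_disc:
  assumes "norm w < 1" "norm a = 1" "0 \<le> t" "t \<le> r"
  shows "radial_pt w a t \<in> radial_disc w r"
  using radial_pt_in_odisc[OF assms(1-3), of r] assms
  by (cases "t = r") (auto simp: dist_radial_pt norm_mult simp del: of_real_diff)

text \<open>The centres are \<open>(r - s) * norm w\<close> apart, which is strictly less than the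
  difference of the radii.\<close>

lemma radial_disc_subset:
  assumes "norm w < 1" "s < r"
  shows "radial_disc w s \<subseteq> radial_odisc w r"
proof
  fix z assume "z \<in> radial_disc w s"
  then have z: "dist ((1 - of_real s) * w) z \<le> s" by simp
  have "(1 - of_real r) * w - (1 - of_real s) * w = of_real (s - r) * w"
    by (simp add: algebra_simps)
  then have "dist ((1 - of_real r) * w) ((1 - of_real s) * w) = (r - s) * norm w"
    using assms(2) by (simp add: dist_norm norm_mult del: of_real_diff)
  also have "\<dots> < (r - s) * 1"
    using assms by (intro mult_strict_left_mono) auto
  finally show "z \<in> radial_odisc w r"
    using z dist_triangle[of "(1 - of_real r) * w" z "(1 - of_real s) * w"] by simp
qed

text \<open>Different parameters put the points on different circles of a nested disjoint family,
  and on one such circle the direction is determined: \<open>t\<close> and \<open>a\<close> act as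
  polar coordinates about \<open>w\<close>.\<close>

lemma radial_pt_eq_imp:
  assumes "norm w < 1" "norm a = 1" "norm b = 1" "0 \<le> t" "0 < u"
    and eq: "radial_pt w a t = radial_pt w b u"
  shows "t = u" "a = b"
proof -
  have "\<not> t < u" "\<not> u < t"
    using radial_pt_notin_disc[of w a u t] radial_pt_in_disc[of w b u u]
      radial_pt_notin_disc[of w b t u] radial_pt_in_disc[of w a t t] assms by auto
  then show "t = u" by simp
  then show "a = b" using eq \<open>0 < u\<close> by simp
qed

lemma compact_radial_segment: "compact (radial_pt w a ` {l..u})"
  by (intro compact_continuous_image continuous_intros) auto

lemma convex_radial_segment: "convex (radial_pt w a ` {l..u})"
proof -
  have "radial_pt w a ` {l..u} = (+) w ` ((\<lambda>t. t *\<^sub>R (a - w)) ` {l..u})"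
    by (simp add: image_image scaleR_conv_of_real)
  moreover have "linear (\<lambda>t. t *\<^sub>R (a - w))"
    by (intro bounded_linear.linear bounded_linear_scaleR_left)
  ultimately show ?thesis
    by (simp add: convex_linear_image convex_translation del: image_add_atLeastAtMost)
qed

section \<open>One step of the inductive approximation\<close>

text \<open>The disc, the two segments and the image of \<open>K\<close> are disjoint compact sets
  whose union has connected complement. Hence the function equal to \<open>p\<close> on the disc, 0
  on the segments and a transported \<open>q\<close> on the image of \<open>K\<close> is a uniform
  limit of polynomials.\<close>

lemma universal_step:
  fixes p q :: "complex poly"
  assumes w: "norm w < 1" and ab: "norm a = 1" "norm b = 1" "a \<noteq> b"
    and K: "compact K" "K \<subset> sphere 0 1"
    and rad: "0 < s" "s < l" "l \<le> u" "u < \<sigma>" and e: "e > 0"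
  obtains p' :: "complex poly" where
    "\<And>z. z \<in> radial_disc w s \<Longrightarrow> norm (poly p' z - poly p z) < e"
    "\<And>c t. c \<in> {a, b} \<Longrightarrow> t \<in> {l..u} \<Longrightarrow> norm (poly p' (radial_pt w c t)) < e"
    "\<And>\<zeta>. \<zeta> \<in> K \<Longrightarrow> norm (poly p' (radial_pt w \<zeta> \<sigma>) - poly q \<zeta>) < e"
proof -
  have K1: "norm \<zeta> = 1" if "\<zeta> \<in> K" for \<zeta> using K(2) that by auto
  define D where "D = radial_disc w s"
  define J where "J = (\<lambda>c. radial_pt w c ` {l..u})"
  define A where "A = (\<lambda>\<zeta>. radial_pt w \<zeta> \<sigma>) ` K"
  define S where "S = D \<union> (J a \<union> (J b \<union> A))"
  have cA: "compact A" unfolding A_def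
    using K(1) by (intro compact_continuous_image continuous_intros)
  have cJ: "compact (J c)" for c unfolding J_def by (rule compact_radial_segment)
  have cS: "compact S" unfolding S_def D_def using cA cJ by (intro compact_Un) auto
  have DJ: "D \<inter> J c = {}" if "norm c = 1" for c
    using radial_pt_notin_disc[OF w that] rad by (force simp: D_def J_def)
  have DA: "D \<inter> A = {}"
    using radial_pt_notin_disc[OF w K1] rad by (force simp: D_def A_def)
  have JA: "J c \<inter> A = {}" if "norm c = 1" for c
  proof -
    have "radial_pt w c t \<noteq> radial_pt w \<zeta> \<sigma>" if "t \<in> {l..u}" "\<zeta> \<in> K" for t \<zeta>
      using radial_pt_eq_imp(1)[OF w \<open>norm c = 1\<close> K1[OF that(2)], of t \<sigma>] that(1) rad by auto
    then show ?thesis by (auto simp: J_def A_def simp del: add_left_cancel)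
  qed
  have JJ: "J a \<inter> J b = {}"
    using radial_pt_eq_imp(2)[OF w ab(1,2)] ab(3) rad by (force simp: J_def)
  have nA: "connected (- A)"
  proof -
    have "bij (\<lambda>\<zeta>. radial_pt w \<zeta> \<sigma>)"
      using rad by (intro o_bij[where g = "\<lambda>z. (z - w) / of_real \<sigma> + w"]) (auto simp: fun_eq_iff field_simps)
    then have "- A = (\<lambda>\<zeta>. radial_pt w \<zeta> \<sigma>) ` (- K)"
      by (simp add: A_def bij_image_Compl_eq)
    then show ?thesis
      using connected_Compl_proper_subset_circle[OF K(2)]
      by (auto intro!: connected_continuous_image continuous_intros)
  qed
  have nJ: "connected (- J c)" for c
    using compact_radial_segment convex_radial_segment
    unfolding J_def by (intro connected_complement_bounded_convex compact_imp_bounded) auto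
  have nD: "connected (- D)"
    unfolding D_def by (intro connected_complement_bounded_convex) auto
  \<comment> \<open>Janiszewski's theorem adds one piece at a time: the pieces are disjoint, and the
    empty intersection counts as connected.\<close>
  have JbA: "connected (- (J b \<union> A))"
    by (rule Janiszewski_connected[OF cJ compact_imp_closed[OF cA] _ nJ nA]) (use JA ab in simp)
  have cJbA: "compact (J b \<union> A)" using cJ cA by (rule compact_Un)
  have JaJbA: "connected (- (J a \<union> (J b \<union> A)))"
    by (rule Janiszewski_connected[OF cJ compact_imp_closed[OF cJbA] _ nJ JbA])
       (use JA JJ ab in \<open>simp add: Int_Un_distrib\<close>)
  have cJaJbA: "compact (J a \<union> (J b \<union> A))" using cJ cJbA by (rule compact_Un)
  have cD: "compact D" by (simp add: D_def)
  have nS: "connected (- S)" unfolding S_def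
    by (rule Janiszewski_connected[OF cD compact_imp_closed[OF cJaJbA] _ nD JaJbA])
       (use DJ DA ab in \<open>simp add: Int_Un_distrib\<close>)
  \<comment> \<open>The circles of radii \<open>r\<close> and \<open>r'\<close> attached to
    \<open>w\<close> miss \<open>S\<close> and sort its pieces: \<open>D\<close> lies inside both,
    the segments between them, \<open>A\<close> outside both.\<close>
  define r where "r = (s + l) / 2"
  define r' where "r' = (u + \<sigma>) / 2"
  have r: "s < r" "r < l" "u < r'" "r' < \<sigma>" "0 < r" "0 < r'" using rad by (auto simp: r_def r'_def)
  define ind where "ind = (\<lambda>r z. if z \<in> radial_odisc w r then 1 else (0::complex))"
  have inD: "z \<in> radial_odisc w r" "z \<in> radial_odisc w r'" if "z \<in> D" for z
    using radial_disc_subset[OF w, of s] that r rad unfolding D_def by (meson less_trans less_le_trans subsetD)+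
  have inJ: "z \<notin> radial_disc w r" "z \<in> radial_odisc w r'" if "z \<in> J c" "norm c = 1" for z c
    using radial_pt_notin_disc[OF w that(2), of r] radial_pt_in_odisc[OF w that(2), of _ r'] that(1) r rad
    by (auto simp: J_def simp del: mem_ball mem_cball)
  have inA: "z \<notin> radial_disc w r" "z \<notin> radial_disc w r'" if "z \<in> A" for z
    using radial_pt_notin_disc[OF w K1, of _ r \<sigma>] radial_pt_notin_disc[OF w K1, of _ r' \<sigma>] that r rad
    by (auto simp: A_def simp del: mem_ball mem_cball)
  have "S \<inter> sphere ((1 - of_real r) * w) r = {}" "S \<inter> sphere ((1 - of_real r') * w) r' = {}"
    using inD inJ[OF _ ab(1)] inJ[OF _ ab(2)] inA unfolding S_def by fastforce+
  then have ind: "poly_approximable S (ind r)" "poly_approximable S (ind r')"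
    unfolding ind_def using cS nS r by (auto intro!: poly_approximable_indicator_ball simp del: mem_ball)
  \<comment> \<open>\<open>Q\<close> is \<open>q\<close> composed with
    \<open>z \<mapsto> w + (z - w) / \<sigma>\<close>, the inverse of the map carrying
    \<open>K\<close> to \<open>A\<close>.\<close>
  define Q where "Q = pcompose q [: w - w / of_real \<sigma>, 1 / of_real \<sigma> :]"
  have Q: "poly Q (radial_pt w \<zeta> \<sigma>) = poly q \<zeta>" for \<zeta>
    using rad by (simp add: Q_def poly_pcompose field_simps)
  define h where "h = (\<lambda>z. ind r z * poly p z + (1 - ind r' z) * poly Q z)"
  have "poly_approximable S h"
    unfolding h_def using cS ind
    by (intro poly_approximable_add poly_approximable_mult poly_approximable_diff compact_imp_bounded) auto
  then obtain p' where p': "\<And>z. z \<in> S \<Longrightarrow> norm (h z - poly p' z) < e"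
    using poly_approximableD e by blast
  show thesis
  proof (rule that[of p'])
    fix z assume z: "z \<in> radial_disc w s"
    then have "h z = poly p z" using inD[of z] by (simp add: h_def ind_def D_def)
    then show "norm (poly p' z - poly p z) < e"
      using p'[of z] z by (simp add: S_def D_def norm_minus_commute)
  next
    fix c t assume c: "c \<in> {a, b}" and t: "t \<in> {l..u}"
    then have z: "radial_pt w c t \<in> J c" "norm c = 1" using ab by (auto simp: J_def)
    then have "h (radial_pt w c t) = 0"
      using inJ[OF z]
      by (auto simp add: h_def ind_def simp del: mem_ball mem_cball dest: subsetD[OF ball_subset_cball])
    then show "norm (poly p' (radial_pt w c t)) < e"
      using p'[of "radial_pt w c t"] z c by (auto simp: S_def)
  next
    fix \<zeta> assume "\<zeta> \<in> K"
    then have z: "radial_pt w \<zeta> \<sigma> \<in> A" by (auto simp: A_def)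
    then have "h (radial_pt w \<zeta> \<sigma>) = poly q \<zeta>"
      using inA[OF z] Q
      by (auto simp add: h_def ind_def simp del: mem_ball mem_cball dest: subsetD[OF ball_subset_cball])
    then show "norm (poly p' (radial_pt w \<zeta> \<sigma>) - poly q \<zeta>) < e"
      using p'[of "radial_pt w \<zeta> \<sigma>"] z by (simp add: S_def norm_minus_commute)
  qed
qed

section \<open>Construction of the universal function\<close>

text \<open>Coefficients are taken from a countable dense set. In the Horner form
  \<open>a + z * poly p z\<close> on the closed unit disc, the errors of \<open>a\<close> and of
  \<open>p\<close> just add, so each gets \<open>e/2\<close>.\<close>

lemma countable_dense_poly:
  obtains Q :: "complex poly set" where "countable Q"
    "\<And>p e. e > 0 \<Longrightarrow> \<exists>q\<in>Q. \<forall>z. norm z \<le> 1 \<longrightarrow> norm (poly p z - poly q z) < e"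
proof -
  obtain D :: "complex set" where D: "countable D" "\<And>U. open U \<Longrightarrow> U \<noteq> {} \<Longrightarrow> \<exists>d\<in>D. d \<in> U"
    using countable_dense_setE by (metis (no_types, lifting))
  define Q where "Q = Poly ` lists D"
  have "countable Q" unfolding Q_def using D(1) by (intro countable_image countable_lists)
  moreover have "\<exists>q\<in>Q. \<forall>z. norm z \<le> 1 \<longrightarrow> norm (poly p z - poly q z) < e" if "e > 0" for p e
    using that
  proof (induction p arbitrary: e)
    case 0
    then show ?case by (intro bexI[of _ 0]) (auto simp: Q_def intro: image_eqI[of _ _ "[]"])
  next
    case (pCons a p)
    obtain q where q: "q \<in> Q" "\<And>z. norm z \<le> 1 \<Longrightarrow> norm (poly p z - poly q z) < e/2"
      using pCons.IH[of "e/2"] pCons.prems by auto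
    obtain d where d: "d \<in> D" "norm (a - d) < e/2"
      using D(2)[of "ball a (e/2)"] pCons.prems by (auto simp: dist_norm)
    have "norm (poly (pCons a p) z - poly (pCons d q) z) < e" if z: "norm z \<le> 1" for z
    proof -
      have "poly (pCons a p) z - poly (pCons d q) z = (a - d) + z * (poly p z - poly q z)"
        by (simp add: algebra_simps)
      also have "norm \<dots> \<le> norm (a - d) + norm z * norm (poly p z - poly q z)"
        by (metis norm_mult norm_triangle_ineq)
      also have "\<dots> \<le> norm (a - d) + norm (poly p z - poly q z)"
        using z by (simp add: mult_left_le_one_le)
      finally show ?thesis using d q(2)[OF z] by simp
    qed
    moreover have "pCons d q \<in> Q"
    proof -
      obtain xs where "q = Poly xs" "xs \<in> lists D" using q(1) by (auto simp: Q_def)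
      then have "pCons d q = Poly (d # xs)" "d # xs \<in> lists D" using d(1) by auto
      then show ?thesis unfolding Q_def by blast
    qed
    ultimately show ?case by blast
  qed
  ultimately show thesis by (rule that)
qed

text \<open>A proper compact subset of the circle misses a member \<open>U\<close> of a countable
  basis that meets the circle. Pairing the sets \<open>sphere 0 1 - U\<close> with a countable dense
  family of polynomials therefore covers all requirements.\<close>

lemma universal_targets:
  obtains K :: "nat \<Rightarrow> complex set" and q :: "nat \<Rightarrow> complex poly" where
    "\<And>n. compact (K n)" "\<And>n. K n \<subset> sphere 0 1"
    "\<And>L \<phi> e N. compact L \<Longrightarrow> L \<subset> sphere 0 1 \<Longrightarrow> continuous_on L \<phi> \<Longrightarrow> e > 0 \<Longrightarrow>
       \<exists>n\<ge>N. L \<subseteq> K n \<and> (\<forall>z\<in>L. norm (\<phi> z - poly (q n) z) < e)"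
proof -
  obtain Q :: "complex poly set" where Q: "countable Q"
    "\<And>p e. e > 0 \<Longrightarrow> \<exists>q\<in>Q. \<forall>z. norm z \<le> 1 \<longrightarrow> norm (poly p z - poly q z) < e"
    using countable_dense_poly by blast
  obtain B :: "complex set set" where B: "countable B" "topological_basis B"
    using ex_countable_basis by blast
  define A where "A = {U \<in> B. U \<inter> sphere 0 1 \<noteq> {}}"
  define C where "C = A \<times> Q"
  have gap: "\<exists>U\<in>A. L \<subseteq> sphere 0 1 - U" if L: "compact L" "L \<subset> sphere 0 1" for L
  proof -
    obtain x where "x \<in> sphere 0 1 - L" using L(2) by blast
    then obtain U where "U \<in> B" "x \<in> U" "U \<subseteq> - L"
      using topological_basisE[OF B(2), of "- L" x] compact_imp_closed[OF L(1)] by (metis Compl_iff DiffE open_Compl)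
    then show ?thesis using L(2) \<open>x \<in> sphere 0 1 - L\<close> by (intro bexI[of _ U]) (auto simp: A_def)
  qed
  have cC: "countable C" using B(1) Q(1) by (auto simp: C_def A_def)
  have "1 \<in> (sphere 0 1 :: complex set)" by simp
  then have "{} \<subset> (sphere 0 1 :: complex set)" by blast
  then obtain U where "U \<in> A" using gap[OF compact_empty] by blast
  moreover obtain r where "r \<in> Q" using Q(2)[OF zero_less_one, of 0] by blast
  ultimately have neC: "C \<noteq> {}" by (auto simp: C_def)
  \<comment> \<open>Dropping the second component of \<open>prod_decode\<close> makes every target
    recur infinitely often: the index \<open>prod_encode (i, N)\<close> is at least
    \<open>N\<close>.\<close>
  define g where "g = (\<lambda>n. from_nat_into C (fst (prod_decode n)))"
  have gC: "g n \<in> C" for n unfolding g_def using neC by (rule from_nat_into)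
  have often: "\<exists>n\<ge>N. g n = c" if "c \<in> C" for c N
  proof -
    obtain i where "from_nat_into C i = c" using from_nat_into_surj[OF cC \<open>c \<in> C\<close>] by blast
    then have "g (prod_encode (i, N)) = c" by (simp add: g_def)
    then show ?thesis by (intro exI[of _ "prod_encode (i, N)"] conjI le_prod_encode_2)
  qed
  show thesis
  proof (rule that[of "\<lambda>n. sphere 0 1 - fst (g n)" "\<lambda>n. snd (g n)"])
    fix n
    have "fst (g n) \<in> A" using gC[of n] by (auto simp: C_def)
    then show "compact (sphere 0 1 - fst (g n))" "sphere 0 1 - fst (g n) \<subset> sphere 0 1"
      using topological_basis_open[OF B(2)] by (auto simp: A_def compact_diff)
  next
    fix L :: "complex set" and \<phi> :: "complex \<Rightarrow> complex" and e :: real and N :: nat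
    assume L: "compact L" "L \<subset> sphere 0 1" and \<phi>: "continuous_on L \<phi>" and e: "e > 0"
    obtain U where U: "U \<in> A" "L \<subseteq> sphere 0 1 - U" using gap[OF L] by blast
    obtain p where p: "\<And>z. z \<in> L \<Longrightarrow> norm (\<phi> z - poly p z) < e/2"
      using poly_approximableD[OF poly_approximable_circle[OF L \<phi>], of "e/2"] e by auto
    obtain r where r: "r \<in> Q" "\<And>z. norm z \<le> 1 \<Longrightarrow> norm (poly p z - poly r z) < e/2"
      using Q(2)[of "e/2" p] e by auto
    obtain n where n: "n \<ge> N" "g n = (U, r)" using often[of "(U, r)" N] U(1) r(1) by (auto simp: C_def)
    have "norm (\<phi> z - poly r z) < e" if "z \<in> L" for z
    proof -
      have "norm z \<le> 1" using that L(2) by auto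
      then show ?thesis
        using p[OF that] r(2)[of z] norm_triangle_ineq[of "\<phi> z - poly p z" "poly p z - poly r z"] by simp
    qed
    then show "\<exists>n\<ge>N. L \<subseteq> sphere 0 1 - fst (g n) \<and> (\<forall>z\<in>L. norm (\<phi> z - poly (snd (g n)) z) < e)"
      using n U(2) by (intro exI[of _ n]) auto
  qed
qed

section \<open>The limit of the inductive construction\<close>

text \<open>If \<open>norm z + d < 1\<close>, the numerical hypothesis holds for all
  \<open>s < 1\<close> close to 1. So the discs exhaust the unit disc, and uniform convergence on
  each of them becomes locally uniform convergence.\<close>

lemma cball_subset_radial_disc:
  assumes "norm w < 1" "norm z + d + 1 \<le> 2 * s" "s \<le> 1"
  shows "cball z d \<subseteq> radial_disc w s"
proof -
  have "dist z ((1 - of_real s) * w) \<le> norm z + norm ((1 - of_real s) * w)"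
    unfolding dist_norm by (rule norm_triangle_ineq4)
  also have "norm ((1 - of_real s) * w) = norm (complex_of_real (1 - s)) * norm w"
    by (simp add: norm_mult)
  also have "\<dots> \<le> (1 - s) * 1"
    using assms unfolding norm_of_real by (intro mult_mono) auto
  finally have "dist z ((1 - of_real s) * w) + d \<le> s" using assms(2) by simp
  then show ?thesis by (simp add: cball_subset_cball_iff)
qed

text \<open>\<open>f\<close> is the limit of polynomials \<open>P n\<close>. Passing to
  \<open>P (Suc n)\<close> makes the function small on the segments between the gaps at
  \<open>\<sigma> n\<close> and \<open>\<sigma> (Suc n)\<close> and realises target \<open>n\<close>
  on the circle of radius \<open>\<sigma> (Suc n)\<close>; later corrections are summably small on
  everything treated before.\<close>

lemma universal_bounded_on_segments:
  fixes \<sigma> \<delta> :: "nat \<Rightarrow> real"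
  assumes w: "norm w < 1" and ab: "norm a = 1" "norm b = 1" "a \<noteq> b"
    and \<sigma>: "\<And>n. 0 < \<sigma> n" "\<And>n. \<sigma> n < 1" "\<sigma> \<longlonglongrightarrow> 1"
    and \<delta>: "\<And>n. 0 < \<delta> n" "\<And>n. \<sigma> n + \<delta> n < 1"
      "\<And>n. \<sigma> n + \<delta> n \<le> \<sigma> (Suc n) - \<delta> (Suc n)"
  obtains f where "f holomorphic_on ball 0 1"
    "\<And>n c t. c \<in> {a, b} \<Longrightarrow> t \<in> {\<sigma> n + \<delta> n .. \<sigma> (Suc n) - \<delta> (Suc n)} \<Longrightarrow> norm (f (radial_pt w c t)) \<le> 1"
    "\<And>L \<phi> e N. compact L \<Longrightarrow> L \<subset> sphere 0 1 \<Longrightarrow> continuous_on L \<phi> \<Longrightarrow> e > 0 \<Longrightarrow>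
       \<exists>n\<ge>N. \<forall>\<zeta>\<in>L. norm (f (radial_pt w \<zeta> (\<sigma> n)) - \<phi> \<zeta>) < e"
proof (rule universal_targets)
  fix K :: "nat \<Rightarrow> complex set" and q :: "nat \<Rightarrow> complex poly"
  assume K: "\<And>n. compact (K n)" "\<And>n. K n \<subset> sphere 0 1"
    and Kq: "\<And>L \<phi> e N. compact L \<Longrightarrow> L \<subset> sphere 0 1 \<Longrightarrow> continuous_on L \<phi> \<Longrightarrow> e > 0 \<Longrightarrow>
       \<exists>n\<ge>N. L \<subseteq> K n \<and> (\<forall>z\<in>L. norm (\<phi> z - poly (q n) z) < e)"
  \<comment> \<open>Half of \<open>\<delta> n\<close> leaves room on both sides: the disc of stage
    \<open>n\<close> contains the circle of radius \<open>\<sigma> n\<close> and the earlier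
    segments, but is disjoint from the next ones.\<close>
  define s where "s n = \<sigma> n + \<delta> n / 2" for n
  \<comment> \<open>The corrections from stage \<open>n\<close> on sum to
    \<open>(1/2) ^ (n + 1)\<close>.\<close>
  define \<epsilon> :: "nat \<Rightarrow> real" where "\<epsilon> n = (1/2) ^ (n + 2)" for n
  have s: "0 < s n" "s n < \<sigma> n + \<delta> n" "\<sigma> n < s n" "s n < 1" for n
    using \<sigma>(1,2)[of n] \<delta>(1,2)[of n] unfolding s_def by auto
  have s_less: "s n < s (Suc n)" for n using s[of n] s[of "Suc n"] \<delta>(3)[of n] \<delta>(1)[of "Suc n"] by linarith
  have s_mono: "s n \<le> s m" if "n \<le> m" for n m
    using less_imp_le[OF s_less] that by (rule lift_Suc_mono_le)
  define step where "step n p p' \<longleftrightarrow>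
    (\<forall>z\<in>radial_disc w (s n). norm (poly p' z - poly p z) < \<epsilon> n) \<and>
    (\<forall>c\<in>{a, b}. \<forall>t\<in>{\<sigma> n + \<delta> n .. \<sigma> (Suc n) - \<delta> (Suc n)}. norm (poly p' (radial_pt w c t)) < \<epsilon> n) \<and>
    (\<forall>\<zeta>\<in>K n. norm (poly p' (radial_pt w \<zeta> (\<sigma> (Suc n))) - poly (q n) \<zeta>) < \<epsilon> n)" for n p p'
  have "\<exists>P. \<forall>n. True \<and> step n (P n) (P (Suc n))"
  proof (rule dependent_nat_choice)
    fix p :: "complex poly" and n :: nat
    have eps: "\<epsilon> n > 0" by (simp add: \<epsilon>_def)
    have less: "\<sigma> (Suc n) - \<delta> (Suc n) < \<sigma> (Suc n)" using \<delta>(1) by simp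
    obtain p' where "step n p p'"
    proof (rule universal_step[OF w ab K(1)[of n] K(2)[of n] s(1,2)[of n] \<delta>(3)[of n] less eps,
          where p = p and q = "q n"])
      fix p' :: "complex poly"
      assume "\<And>z. z \<in> radial_disc w (s n) \<Longrightarrow> norm (poly p' z - poly p z) < \<epsilon> n"
        "\<And>c t. c \<in> {a, b} \<Longrightarrow> t \<in> {\<sigma> n + \<delta> n .. \<sigma> (Suc n) - \<delta> (Suc n)} \<Longrightarrow> norm (poly p' (radial_pt w c t)) < \<epsilon> n"
        "\<And>\<zeta>. \<zeta> \<in> K n \<Longrightarrow> norm (poly p' (radial_pt w \<zeta> (\<sigma> (Suc n))) - poly (q n) \<zeta>) < \<epsilon> n"
      then show thesis by (intro that[of p']) (simp add: step_def del: mem_cball)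
    qed
    then show "\<exists>p'. True \<and> step n p p'" by blast
  qed simp
  then obtain P where P: "\<And>n. step n (P n) (P (Suc n))" by blast
  have disc_mono: "radial_disc w (s n) \<subseteq> radial_disc w (s m)" if "n \<le> m" for n m
  proof (cases "s n = s m")
    case False
    then have "s n < s m" using s_mono[OF that] by simp
    from radial_disc_subset[OF w this] ball_subset_cball show ?thesis by (rule order_trans)
  qed simp
  \<comment> \<open>The subtracted term keeps the telescoping sum exact, which the induction on
    \<open>m\<close> needs.\<close>
  have close: "norm (poly (P m) z - poly (P n) z) \<le> (1/2) ^ (n + 1) - (1/2) ^ (m + 1)"
    if "n \<le> m" "z \<in> radial_disc w (s n)" for n m z
    using that(1)
  proof (induction m rule: dec_induct)
    case (step m)
    have "norm (poly (P (Suc m)) z - poly (P m) z) < \<epsilon> m"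
      using P[of m] disc_mono[OF step.hyps(1)] that(2) unfolding step_def by blast
    moreover have "norm (poly (P (Suc m)) z - poly (P n) z) \<le>
      norm (poly (P (Suc m)) z - poly (P m) z) + norm (poly (P m) z - poly (P n) z)"
      using norm_triangle_ineq[of "poly (P (Suc m)) z - poly (P m) z" "poly (P m) z - poly (P n) z"] by simp
    moreover have "\<epsilon> m = (1/2) ^ (m + 1) - (1/2) ^ (Suc m + 1)" by (simp add: \<epsilon>_def)
    ultimately show ?case using step.IH by linarith
  qed simp
  have close': "norm (poly (P m) z - poly (P n) z) \<le> (1/2) ^ (n + 1)"
    if "n \<le> m" "z \<in> radial_disc w (s n)" for n m z
    using close[OF that] zero_le_power[of "1/2::real" "m+1"] by linarith
  have half: "(\<lambda>n. (1/2) ^ (n + 1) :: real) \<longlonglongrightarrow> 0"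
    by (intro LIMSEQ_ignore_initial_segment LIMSEQ_realpow_zero) auto
  define f where "f z = lim (\<lambda>m. poly (P m) z)" for z
  have conv: "(\<lambda>m. poly (P m) z) \<longlonglongrightarrow> f z" if z: "z \<in> radial_disc w (s n)" for z n
  proof -
    have "Cauchy (\<lambda>m. poly (P m) z)"
    proof (rule CauchyI')
      fix e :: real assume "e > 0"
      then have "\<forall>\<^sub>F k in sequentially. (1/2) ^ (k + 1) < e" using half by (intro order_tendstoD(2))
      then have "\<forall>\<^sub>F k in sequentially. (1/2) ^ (k + 1) < e \<and> k \<ge> n"
        using eventually_ge_at_top[of n] by (rule eventually_conj)
      then obtain M where M: "(1/2) ^ (k + 1) < e \<and> k \<ge> n" if "k \<ge> M" for k
        by (auto simp: eventually_at_top_linorder)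
      have "norm (poly (P k) z - poly (P m) z) < e" if "m \<ge> M" "m < k" for k m
        using close'[of m k z] M[of m] that z disc_mono[of n m] by fastforce
      then show "\<exists>M. \<forall>m\<ge>M. \<forall>k>m. dist (poly (P m) z) (poly (P k) z) < e"
        by (metis dist_commute dist_norm)
    qed
    then show ?thesis unfolding f_def using Cauchy_convergent convergent_LIMSEQ_iff by blast
  qed
  have fP: "norm (f z - poly (P n) z) \<le> (1/2) ^ (n + 1)" if z: "z \<in> radial_disc w (s n)" for z n
  proof (rule tendsto_upperbound)
    show "(\<lambda>m. norm (poly (P m) z - poly (P n) z)) \<longlonglongrightarrow> norm (f z - poly (P n) z)"
      using conv[OF z] by (intro tendsto_intros)
    show "\<forall>\<^sub>F m in sequentially. norm (poly (P m) z - poly (P n) z) \<le> (1/2) ^ (n + 1)"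
      using close'[OF _ z] by (auto simp: eventually_at_top_linorder)
  qed auto
  have ulim: "uniform_limit (radial_disc w (s n)) (\<lambda>m z. poly (P m) z) f sequentially" for n
  proof (rule uniform_limitI)
    fix e :: real assume "e > 0"
    then have "\<forall>\<^sub>F k in sequentially. (1/2) ^ (k + 1) < e" using half by (intro order_tendstoD(2))
    then have "\<forall>\<^sub>F k in sequentially. (1/2) ^ (k + 1) < e \<and> k \<ge> n"
      using eventually_ge_at_top[of n] by (rule eventually_conj)
    then show "\<forall>\<^sub>F k in sequentially. \<forall>z\<in>radial_disc w (s n). dist (poly (P k) z) (f z) < e"
    proof eventually_elim
      case (elim k)
      show ?case
      proof
        fix z assume "z \<in> radial_disc w (s n)"
        then have "z \<in> radial_disc w (s k)" using disc_mono[of n k] elim by blast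
        then show "dist (poly (P k) z) (f z) < e" 
          using fP[of z k] elim by (simp add: dist_norm norm_minus_commute del: mem_cball)
      qed
    qed
  qed
  show thesis
  proof (rule that[of f])
    show "f holomorphic_on ball 0 1"
    proof (rule holomorphic_uniform_sequence[where f = "\<lambda>m z. poly (P m) z"])
      fix z :: complex assume z: "z \<in> ball 0 1"
      define d where "d = (1 - norm z) / 2"
      have d: "d > 0" "norm z + d < 1" using z by (auto simp: d_def field_simps)
      then have "\<forall>\<^sub>F n in sequentially. (norm z + d + 1) / 2 < \<sigma> n"
        using \<sigma>(3) by (intro order_tendstoD(1)) auto
      then obtain n where "(norm z + d + 1) / 2 < \<sigma> n" by (auto simp: eventually_at_top_linorder)
      then have "cball z d \<subseteq> radial_disc w (s n)"
        using s[of n] by (intro cball_subset_radial_disc w) auto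
      then have "uniform_limit (cball z d) (\<lambda>m z. poly (P m) z) f sequentially"
        by (rule uniform_limit_on_subset[OF ulim])
      moreover have "cball z d \<subseteq> ball 0 1"
        using d by (simp add: cball_subset_ball_iff dist_norm add.commute)
      ultimately show "\<exists>d>0. cball z d \<subseteq> ball 0 1 \<and> uniform_limit (cball z d) (\<lambda>m z. poly (P m) z) f sequentially"
        using d by blast
    qed (auto intro!: holomorphic_intros)
  next
    fix n c t assume c: "c \<in> {a, b}" and t: "t \<in> {\<sigma> n + \<delta> n .. \<sigma> (Suc n) - \<delta> (Suc n)}"
    define z where "z = radial_pt w c t"
    \<comment> \<open>The segment lies in the disc of stage \<open>Suc n\<close>, so smallness of
      \<open>P (Suc n)\<close> on it passes to \<open>f\<close> up to the tail of the
      corrections.\<close>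
    have "z \<in> radial_disc w (s (Suc n))"
      unfolding z_def using c ab t \<sigma>(1)[of n] \<delta>(1)[of n] s[of "Suc n"] \<delta>(1)[of "Suc n"] w
      by (intro radial_pt_in_disc) auto
    then have "norm (f z - poly (P (Suc n)) z) \<le> (1/2) ^ (Suc n + 1)" by (rule fP)
    moreover have "norm (poly (P (Suc n)) z) < \<epsilon> n"
      using P[of n] c t unfolding step_def z_def by blast
    moreover have "\<epsilon> n \<le> 1/2" "(1/2) ^ (Suc n + 1) \<le> (1/2::real)"
      using power_decreasing[of 1 "n + 2" "1/2 :: real"] by (auto simp: \<epsilon>_def)
    ultimately have "norm (f z) \<le> 1"
      using norm_triangle_ineq[of "f z - poly (P (Suc n)) z" "poly (P (Suc n)) z"] by simp
    then show "norm (f (radial_pt w c t)) \<le> 1" by (simp add: z_def)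
  next
    fix L :: "complex set" and \<phi> :: "complex \<Rightarrow> complex" and e :: real and N :: nat
    assume L: "compact L" "L \<subset> sphere 0 1" and \<phi>: "continuous_on L \<phi>" and e: "e > 0"
    have "\<forall>\<^sub>F k in sequentially. (1/2) ^ (k + 1) < e/3" by (rule order_tendstoD(2)[OF half]) (use e in simp)
    then obtain M where M: "(1/2) ^ (k + 1) < e/3" if "k \<ge> M" for k
      by (auto simp: eventually_at_top_linorder)
    obtain n where n: "n \<ge> max N M" "L \<subseteq> K n" "\<And>z. z \<in> L \<Longrightarrow> norm (\<phi> z - poly (q n) z) < e/3"
      using Kq[OF L \<phi>, of "e/3" "max N M"] e by auto
    have "norm (f (radial_pt w \<zeta> (\<sigma> (Suc n))) - \<phi> \<zeta>) < e" if \<zeta>: "\<zeta> \<in> L" for \<zeta>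
    proof -
      define z where "z = radial_pt w \<zeta> (\<sigma> (Suc n))"
      have "norm \<zeta> = 1" using \<zeta> L(2) by auto
      then have "z \<in> radial_disc w (s (Suc n))"
        unfolding z_def using \<sigma>(1)[of "Suc n"] s[of "Suc n"] w by (intro radial_pt_in_disc) auto
      then have "norm (f z - poly (P (Suc n)) z) < e/3" using fP M[of "Suc n"] n(1) by fastforce
      moreover have "norm (poly (P (Suc n)) z - poly (q n) \<zeta>) < \<epsilon> n"
        using P[of n] n(2) \<zeta> unfolding step_def z_def by blast
      moreover have "\<epsilon> n < e/3" using M[of "Suc n"] n(1) by (simp add: \<epsilon>_def)
      moreover have "norm (f z - \<phi> \<zeta>) \<le> norm (f z - poly (P (Suc n)) z) +
          norm (poly (P (Suc n)) z - poly (q n) \<zeta>) + norm (\<phi> \<zeta> - poly (q n) \<zeta>)"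
        by norm
      ultimately show ?thesis using n(3)[OF \<zeta>] unfolding z_def by linarith
    qed
    \<comment> \<open>Target \<open>n\<close> is met on the circle of radius
      \<open>\<sigma> (Suc n)\<close>, hence the witness \<open>Suc n\<close>.\<close>
    then show "\<exists>n\<ge>N. \<forall>\<zeta>\<in>L. norm (f (radial_pt w \<zeta> (\<sigma> n)) - \<phi> \<zeta>) < e"
      using n(1) by (intro exI[of _ "Suc n"]) auto
  qed
qed

section \<open>Circles attached to another centre\<close>

text \<open>Near \<open>a\<close> the circle \<open>w + r (\<zeta> - w)\<close> lies, to first order, at distance
  \<open>(1 - r) (1 - Re (w * cnj a))\<close> from the unit circle; equating this for \<open>w\<^sub>1\<close> and \<open>w\<^sub>2\<close> gives the ratio \<open>h / k\<close>.\<close>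

lemma radial_hits_circle:
  fixes w\<^sub>1 w\<^sub>2 a :: complex
  assumes w: "norm w\<^sub>1 < 1" and a: "norm a = 1"
    and c: "c \<ge> 0" "c < (1 - Re (w\<^sub>2 * cnj a)) / (1 - Re (w\<^sub>1 * cnj a))"
    and d: "(1 - Re (w\<^sub>2 * cnj a)) / (1 - Re (w\<^sub>1 * cnj a)) < d"
  shows "\<forall>\<^sub>F k in at_right 0. \<exists>h\<in>{c * k..d * k}. norm (radial_pt w\<^sub>1 a (1 - h) - of_real k * w\<^sub>2) = 1 - k"
proof -
  define g1 where "g1 = 1 - Re (w\<^sub>1 * cnj a)"
  define g2 where "g2 = 1 - Re (w\<^sub>2 * cnj a)"
  have "Re (w\<^sub>1 * cnj a) \<le> norm w\<^sub>1" using complex_Re_le_cmod[of "w\<^sub>1 * cnj a"] a by (simp add: norm_mult)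
  then have g1: "g1 > 0" using w by (simp add: g1_def)
  have cd: "g2 - c * g1 > 0" "g2 - d * g1 < 0"
    using c d g1 unfolding g1_def[symmetric] g2_def[symmetric] by (simp_all add: field_simps)
  define G where "G k h = norm (radial_pt w\<^sub>1 a (1 - h) - of_real k * w\<^sub>2)" for k h
  define v where "v x = of_real x * (a - w\<^sub>1) + w\<^sub>2" for x :: real
  have a2: "(Re a)\<^sup>2 + (Im a)\<^sup>2 = 1" using a cmod_power2[of a] by simp
  \<comment> \<open>For small \<open>k > 0\<close> the sign of the difference is that of
    \<open>g2 - x * g1\<close>, positive at \<open>x = c\<close> and negative at
    \<open>x = d\<close>; the intermediate value theorem in \<open>h\<close> then gives the
    hit.\<close>
  have id: "(G k (x * k))\<^sup>2 - (1 - k)\<^sup>2 = k * (2 * (g2 - x * g1) + k * ((norm (v x))\<^sup>2 - 1))" for x k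
  proof -
    have "radial_pt w\<^sub>1 a (1 - x * k) - of_real k * w\<^sub>2 = a - of_real k * v x"
      by (simp add: v_def algebra_simps)
    then have "(G k (x * k))\<^sup>2 = (Re a - k * Re (v x))\<^sup>2 + (Im a - k * Im (v x))\<^sup>2"
      by (simp add: G_def cmod_power2)
    also have "\<dots> = ((Re a)\<^sup>2 + (Im a)\<^sup>2) - 2 * k * (Re (v x) * Re a + Im (v x) * Im a) + k\<^sup>2 * (norm (v x))\<^sup>2"
      unfolding cmod_power2 by algebra
    also have "Re (v x) * Re a + Im (v x) * Im a =
       x * ((Re a)\<^sup>2 + (Im a)\<^sup>2 - Re (w\<^sub>1 * cnj a)) + Re (w\<^sub>2 * cnj a)"
      by (simp add: v_def algebra_simps power2_eq_square)
    also have "\<dots> = x * g1 + 1 - g2" unfolding a2 g1_def g2_def by simp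
    finally show ?thesis unfolding a2 by (simp add: algebra_simps power2_eq_square)
  qed
  have lim: "((\<lambda>k. 2 * (g2 - x * g1) + k * ((norm (v x))\<^sup>2 - 1)) \<longlongrightarrow> 2 * (g2 - x * g1) + 0 * ((norm (v x))\<^sup>2 - 1)) (at_right 0)" for x
    by (intro tendsto_intros)
  have "\<forall>\<^sub>F k in at_right 0. 2 * (g2 - c * g1) + k * ((norm (v c))\<^sup>2 - 1) > 0"
    by (rule order_tendstoD(1)[OF lim]) (use cd in simp)
  moreover have "\<forall>\<^sub>F k in at_right 0. 2 * (g2 - d * g1) + k * ((norm (v d))\<^sup>2 - 1) < 0"
    by (rule order_tendstoD(2)[OF lim]) (use cd in simp)
  moreover have "\<forall>\<^sub>F k::real in at_right 0. 0 < k \<and> k < 1"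
    unfolding eventually_at_right_field by (intro exI[of _ 1]) auto
  ultimately show ?thesis
  proof eventually_elim
    case (elim k)
    have "(1 - k)\<^sup>2 < (G k (c * k))\<^sup>2" using id[of k c] elim by (smt (verit) mult_pos_pos)
    then have "1 - k \<le> G k (c * k)" using power2_less_imp_less[of "1 - k" "G k (c * k)"] by (simp add: G_def)
    moreover have "(G k (d * k))\<^sup>2 < (1 - k)\<^sup>2" using id[of k d] elim by (smt (verit) mult_pos_neg)
    then have "G k (d * k) \<le> 1 - k" using power2_less_imp_less[of "G k (d * k)" "1 - k"] elim by simp
    moreover have "c * k \<le> d * k" using c d elim by (intro mult_right_mono) auto
    moreover have "isCont (G k) x" for x unfolding G_def by (intro continuous_intros)
    ultimately have "\<exists>h\<ge>c * k. h \<le> d * k \<and> G k h = 1 - k" by (intro IVT2) auto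
    then show ?case unfolding G_def by auto
  qed
qed

section \<open>Gaps along a sparse sequence\<close>

text \<open>Take the least \<open>N\<close> with \<open>h N < x\<close>; it is positive since
  \<open>x \<le> h 0\<close>. Then \<open>x\<close> lies between \<open>h N\<close> and the
  preceding value and, being outside the interval between their gaps, falls into one of these two
  gaps.\<close>

lemma gap_location:
  fixes h :: "nat \<Rightarrow> real"
  assumes h: "\<And>n. 0 < h n" "h \<longlonglongrightarrow> 0" and \<eta>: "0 < \<eta>" and x: "0 < x" "x \<le> h 0"
    and none: "\<And>n. x \<notin> {(1 + \<eta>) * h (Suc n) .. (1 - \<eta>) * h n}"
  obtains n where "(1 - \<eta>) * h n < x" "x < (1 + \<eta>) * h n"
proof -
  have "\<forall>\<^sub>F n in sequentially. h n < x" using h(2) x(1) by (rule order_tendstoD(2))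
  then have ex: "\<exists>n. h n < x" by (auto simp: eventually_at_top_linorder)
  define N where "N = (LEAST n. h n < x)"
  have N: "h N < x" unfolding N_def using ex by (rule LeastI_ex)
  then have "N \<noteq> 0" using x(2) by (metis not_less)
  then obtain m where m: "N = Suc m" by (cases N) auto
  have "\<not> h m < x" using not_less_Least[of m "\<lambda>n. h n < x"] m unfolding N_def by simp
  have pos: "\<eta> * h n > 0" for n using h(1) \<eta> by simp
  consider "x < (1 + \<eta>) * h N" | "(1 - \<eta>) * h m < x" using none[of m] m by force
  then show thesis
  proof cases
    case 1
    then show thesis using that[of N] N pos[of N] by (simp add: algebra_simps)
  next
    case 2
    then show thesis using that[of m] \<open>\<not> h m < x\<close> pos[of m] by (simp add: algebra_simps)
  qed
qed

text \<open>As \<open>x / y\<close> lies in \<open>[\<kappa>, \<Lambda>]\<close>, the lower bound \<open>\<kappa>\<close> excludes that both points lie in the same gap, and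
  \<open>\<Lambda>\<close> together with the sparseness \<open>\<theta>\<close> excludes that they lie in distinct gaps.\<close>

lemma one_avoids_gaps:
  fixes h :: "nat \<Rightarrow> real"
  assumes h: "\<And>n. 0 < h n" "h \<longlonglongrightarrow> 0" and \<theta>: "\<And>n. h (Suc n) \<le> \<theta> * h n" "0 < \<theta>"
    and \<eta>: "0 < \<eta>" "1 + \<eta> < \<kappa> * (1 - \<eta>)" and \<kappa>: "1 < \<kappa>" "1 \<le> \<Lambda>" "\<theta> * \<kappa> * \<Lambda> \<le> 1"
    and xy: "0 < y" "\<kappa> * y \<le> x" "x \<le> \<Lambda> * y" "x \<le> h 0"
  shows "\<exists>n. \<exists>z\<in>{x, y}. z \<in> {(1 + \<eta>) * h (Suc n) .. (1 - \<eta>) * h n}"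
proof (rule ccontr)
  assume no: "\<not> ?thesis"
  have yx: "y < x" using xy \<kappa> by (smt (verit) mult_less_cancel_right1)
  obtain n where n: "(1 - \<eta>) * h n < x" "x < (1 + \<eta>) * h n"
    by (rule gap_location[OF h \<eta>(1), of x]) (use no xy yx in auto)
  obtain m where m: "(1 - \<eta>) * h m < y" "y < (1 + \<eta>) * h m"
    by (rule gap_location[OF h \<eta>(1), of y]) (use no xy yx in auto)
  have \<theta>\<kappa>: "\<theta> * \<kappa> \<le> 1"
  proof -
    have "\<theta> * \<kappa> * 1 \<le> \<theta> * \<kappa> * \<Lambda>" using \<theta> \<kappa> by (intro mult_left_mono) auto
    then show ?thesis using \<kappa> by simp
  qed
  have \<theta>1: "\<theta> \<le> 1" using \<theta>\<kappa> \<kappa> \<theta>(2) by (smt (verit) mult_less_cancel_left2)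
  have dec: "h j \<le> h i" if "i \<le> j" for i j
  proof (rule lift_Suc_antimono_le[of h, OF _ that])
    fix k
    have "\<theta> * h k \<le> 1 * h k" using \<theta>1 h(1)[of k] by (intro mult_right_mono) auto
    then show "h (Suc k) \<le> h k" using \<theta>(1)[of k] by simp
  qed
  \<comment> \<open>Sparseness contributes the factor \<open>\<theta>\<close>, and
    \<open>\<kappa>\<close> absorbs the width of the gap.\<close>
  have jump: "(1 + \<eta>) * h j < \<theta> * \<kappa> * ((1 - \<eta>) * h i)" if "i < j" for i j
  proof -
    have "h j \<le> \<theta> * h i" using dec[of "Suc i" j] \<theta>(1)[of i] that by simp
    then have "(1 + \<eta>) * h j \<le> (1 + \<eta>) * (\<theta> * h i)" using \<eta> by (intro mult_left_mono) auto
    also have "\<dots> < (\<kappa> * (1 - \<eta>)) * (\<theta> * h i)" using \<eta> \<theta>(2) h(1)[of i] by (intro mult_strict_right_mono) auto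
    finally show ?thesis by (simp add: mult_ac)
  qed
  consider "n = m" | "m < n" | "n < m" by linarith
  then show False
  proof cases
    case 1
    have "x < (1 + \<eta>) * h m" using n 1 by simp
    also have "\<dots> < \<kappa> * (1 - \<eta>) * h m" using \<eta>(2) h(1) by (intro mult_strict_right_mono) auto
    also have "\<dots> < \<kappa> * y" using m(1) \<kappa>(1) by (simp add: mult.assoc)
    finally show False using xy by simp
  next
    \<comment> \<open>The gap of \<open>x\<close> is closer to 0 than that of \<open>y\<close>,
      against \<open>y < x\<close>.\<close>
    case 2
    have "x < \<theta> * \<kappa> * ((1 - \<eta>) * h m)" using n(2) jump[OF 2] by simp
    also have "\<dots> < \<theta> * \<kappa> * y" using m(1) \<theta> \<kappa> by (intro mult_strict_left_mono) auto
    also have "\<dots> \<le> 1 * y" using \<theta>\<kappa> xy(1) by (intro mult_right_mono) auto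
    finally show False using yx by simp
  next
    \<comment> \<open>The gap of \<open>y\<close> is closer to 0, which makes \<open>y\<close> too
      small for \<open>x \<le> \<Lambda> * y\<close>.\<close>
    case 3
    have "y < \<theta> * \<kappa> * ((1 - \<eta>) * h n)" using m(2) jump[OF 3] by simp
    also have "\<dots> < \<theta> * \<kappa> * x" using n(1) \<theta> \<kappa> by (intro mult_strict_left_mono) auto
    also have "\<dots> \<le> \<theta> * \<kappa> * (\<Lambda> * y)" using xy(3) \<theta> \<kappa> by (intro mult_left_mono) auto
    also have "\<dots> = (\<theta> * \<kappa> * \<Lambda>) * y" by simp
    also have "\<dots> \<le> 1 * y" using \<kappa>(3) xy(1) by (intro mult_right_mono) auto
    finally show False by simp
  qed
qed

section \<open>Universality at one centre and its failure at another\<close>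

lemma radius_seq_sparse:
  assumes "radius_seq \<rho>" "\<theta> > 0"
  obtains m where "strict_mono m" "\<And>n. 0 < \<rho> (m n)" "\<And>n. 1 - \<rho> (m (Suc n)) \<le> \<theta> * (1 - \<rho> (m n))"
proof -
  have lim: "\<rho> \<longlonglongrightarrow> 1" and lt: "\<And>n. \<rho> n < 1" using assms(1) by (auto simp: radius_seq_def)
  have "\<exists>m. \<forall>n. 0 < \<rho> (m n) \<and> (m n < m (Suc n) \<and> 1 - \<rho> (m (Suc n)) \<le> \<theta> * (1 - \<rho> (m n)))"
  proof (rule dependent_nat_choice)
    have "\<forall>\<^sub>F n in sequentially. 0 < \<rho> n" using lim by (rule order_tendstoD(1)) simp
    then show "\<exists>n. 0 < \<rho> n" by (auto simp: eventually_at_top_linorder)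
  next
    fix k n :: nat assume "0 < \<rho> k"
    \<comment> \<open>Besides sparseness, the maximum with 0 keeps the next radius positive.\<close>
    have "max 0 (1 - \<theta> * (1 - \<rho> k)) < 1" using assms(2) lt[of k] by simp
    then have "\<forall>\<^sub>F j in sequentially. max 0 (1 - \<theta> * (1 - \<rho> k)) < \<rho> j" using lim by (intro order_tendstoD(1))
    then have "\<forall>\<^sub>F j in sequentially. max 0 (1 - \<theta> * (1 - \<rho> k)) < \<rho> j \<and> k < j"
      using eventually_gt_at_top by (rule eventually_conj)
    then obtain j where "max 0 (1 - \<theta> * (1 - \<rho> k)) < \<rho> j \<and> k < j"
      by (auto simp: eventually_at_top_linorder)
    then show "\<exists>j. 0 < \<rho> j \<and> k < j \<and> 1 - \<rho> j \<le> \<theta> * (1 - \<rho> k)" by (intro exI[of _ j]) auto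
  qed
  then obtain m where "\<And>n. 0 < \<rho> (m n) \<and> (m n < m (Suc n) \<and> 1 - \<rho> (m (Suc n)) \<le> \<theta> * (1 - \<rho> (m n)))" by blast
  then show thesis by (intro that[of m]) (auto simp: strict_mono_Suc_iff)
qed

text \<open>Good approximations occur at arbitrarily late indices, so indices with errors below
  \<open>1 / (k + 1)\<close> can be picked recursively in strictly increasing order.\<close>

lemma abel_universal_wrtI:
  assumes hol: "f holomorphic_on ball 0 1"
    and approx: "\<And>L \<phi> e N. compact L \<Longrightarrow> L \<subset> sphere 0 1 \<Longrightarrow> continuous_on L \<phi> \<Longrightarrow> e > 0 \<Longrightarrow>
       \<exists>n\<ge>N. \<forall>\<zeta>\<in>L. norm (f (radial_pt w \<zeta> (\<rho> n)) - \<phi> \<zeta>) < e"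
  shows "f \<in> abel_universal_wrt w \<rho>"
  unfolding abel_universal_wrt_def mem_Collect_eq
proof (intro conjI allI impI hol)
  fix K :: "complex set" and \<phi> :: "complex \<Rightarrow> complex"
  assume "compact K \<and> K \<subseteq> sphere 0 1 \<and> K \<noteq> sphere 0 1 \<and> continuous_on K \<phi>"
  then have K: "compact K" "K \<subset> sphere 0 1" "continuous_on K \<phi>" by auto
  define good where "good k n \<longleftrightarrow> (\<forall>\<zeta>\<in>K. norm (f (radial_pt w \<zeta> (\<rho> n)) - \<phi> \<zeta>) < inverse (real (Suc k)))" for k n
  have ex: "\<exists>n\<ge>N. good k n" for k N
    unfolding good_def by (rule approx[OF K]) simp
  have "\<exists>n. \<forall>k. good k (n k) \<and> n k < n (Suc k)"
  proof (rule dependent_nat_choice)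
    show "\<exists>n. good 0 n" using ex by blast
    show "\<exists>j. good (Suc k) j \<and> n < j" for n k using ex[of "Suc n" "Suc k"] by (auto simp: Suc_le_eq)
  qed
  then obtain n where n: "\<And>k. good k (n k)" "\<And>k. n k < n (Suc k)" by blast
  have "uniform_limit K (\<lambda>k \<zeta>. f (radial_pt w \<zeta> (\<rho> (n k)))) \<phi> sequentially"
  proof (rule uniform_limitI)
    fix e :: real assume "e > 0"
    then have "\<forall>\<^sub>F k in sequentially. inverse (real (Suc k)) < e"
      using LIMSEQ_inverse_real_of_nat by (rule order_tendstoD(2)[rotated])
    then show "\<forall>\<^sub>F k in sequentially. \<forall>\<zeta>\<in>K. dist (f (radial_pt w \<zeta> (\<rho> (n k)))) (\<phi> \<zeta>) < e"
    proof eventually_elim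
      case (elim k)
      then show ?case using n(1)[of k] unfolding good_def dist_norm by (meson less_trans)
    qed
  qed
  then show "\<exists>n. strict_mono n \<and> uniform_limit K (\<lambda>k \<zeta>. f (radial_pt w \<zeta> (\<rho> (n k)))) \<phi> sequentially"
    using n(2) by (intro exI[of _ n]) (simp add: strict_mono_Suc_iff)
qed

text \<open>The constant 3 on two closed arcs around \<open>u\<close> and \<open>- u\<close> is the
  target that fails. The equation \<open>norm (z - of_real k * w) = 1 - k\<close> says that
  \<open>z\<close> lies on the circle of radius \<open>1 - k\<close> attached to \<open>w\<close>; a
  value of modulus at most 1 there is too far from 3.\<close>

lemma not_abel_universal_if_bounded:
  fixes u :: complex
  assumes u: "norm u = 1"
    and small: "\<And>d::real. d > 0 \<Longrightarrow> \<forall>\<^sub>F k::real in at_right 0. \<exists>z. norm (z - of_real k * w) = 1 - k \<and>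
       (dist z u < d \<or> dist z (- u) < d) \<and> norm (f z) \<le> 1"
    and w: "norm w < 1"
  shows "f \<notin> abel_universal w"
proof
  assume "f \<in> abel_universal w"
  then obtain r where r: "radius_seq r" and f: "f \<in> abel_universal_wrt w r"
    by (auto simp: abel_universal_def)
  \<comment> \<open>These arcs omit \<open>\<i> * u\<close>, so \<open>K\<close> is proper, yet
    contain every point of the unit circle within 1/2 of \<open>u\<close> or
    \<open>- u\<close>.\<close>
  define K where "K = sphere 0 1 \<inter> {\<zeta>. \<bar>Re (\<zeta> * cnj u)\<bar> \<ge> 1/2}"
  have "closed {\<zeta>. \<bar>Re (\<zeta> * cnj u)\<bar> \<ge> 1/2}"
    by (intro closed_Collect_le continuous_intros)
  then have "compact K" unfolding K_def by (intro compact_Int_closed compact_sphere)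
  moreover have uu: "u * cnj u = 1" using u by (simp add: complex_norm_square[symmetric])
  have "\<i> * u \<in> sphere 0 1" using u by (simp add: norm_mult)
  moreover have "\<i> * u \<notin> K" using uu by (simp add: K_def mult.assoc)
  moreover have "K \<subseteq> sphere 0 1" by (auto simp: K_def)
  ultimately have "compact K \<and> K \<subseteq> sphere 0 1 \<and> K \<noteq> sphere 0 1 \<and> continuous_on K (\<lambda>_. 3 :: complex)"
    by auto
  then obtain n :: "nat \<Rightarrow> nat" where n: "strict_mono n"
    and lim: "uniform_limit K (\<lambda>k \<zeta>. f (radial_pt w \<zeta> (r (n k)))) (\<lambda>_. 3) sequentially"
    using f unfolding abel_universal_wrt_def mem_Collect_eq by blast
  have ev: "\<forall>\<^sub>F k in sequentially. \<forall>\<zeta>\<in>K. dist (f (radial_pt w \<zeta> (r (n k)))) 3 < 1"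
    using lim by (rule uniform_limitD) simp
  have "filterlim (\<lambda>k. 1 - r (n k)) (at_right 0) sequentially"
    unfolding filterlim_at
  proof
    have "r \<longlonglongrightarrow> 1" using r by (simp add: radius_seq_def)
    then have "(\<lambda>k. r (n k)) \<longlonglongrightarrow> 1" using LIMSEQ_subseq_LIMSEQ[OF _ n] by (auto simp: o_def)
    then have "(\<lambda>k. 1 - r (n k)) \<longlonglongrightarrow> 1 - 1" by (intro tendsto_intros)
    then show "(\<lambda>k. 1 - r (n k)) \<longlonglongrightarrow> 0" by simp
    show "\<forall>\<^sub>F k in sequentially. 1 - r (n k) \<in> {0<..} \<and> 1 - r (n k) \<noteq> 0"
      using r by (auto simp: radius_seq_def intro!: always_eventually less_imp_neq)
  qed
  \<comment> \<open>The point of the unit circle corresponding to \<open>z\<close> is at distance at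
    most \<open>2 * k < 1/4\<close> from \<open>z\<close>; with \<open>z\<close> within 1/4 of
    \<open>u\<close> or \<open>- u\<close>, it belongs to \<open>K\<close>.\<close>
  moreover have "\<forall>\<^sub>F k::real in at_right 0. k < 1/8"
    unfolding eventually_at_right_field by (intro exI[of _ "1/8"]) auto
  with small[of "1/4"] have "\<forall>\<^sub>F k::real in at_right 0. (\<exists>z. norm (z - of_real k * w) = 1 - k \<and>
       (dist z u < 1/4 \<or> dist z (- u) < 1/4) \<and> norm (f z) \<le> 1) \<and> k < 1/8"
    by (intro eventually_conj) auto
  ultimately have "\<forall>\<^sub>F j in sequentially. (\<exists>z. norm (z - of_real (1 - r (n j)) * w) = 1 - (1 - r (n j)) \<and>
       (dist z u < 1/4 \<or> dist z (- u) < 1/4) \<and> norm (f z) \<le> 1) \<and> 1 - r (n j) < 1/8"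
    by (rule eventually_compose_filterlim[rotated])
  with ev have "\<forall>\<^sub>F j in sequentially. (\<forall>\<zeta>\<in>K. dist (f (radial_pt w \<zeta> (r (n j)))) 3 < 1) \<and>
       (\<exists>z. norm (z - of_real (1 - r (n j)) * w) = 1 - (1 - r (n j)) \<and>
       (dist z u < 1/4 \<or> dist z (- u) < 1/4) \<and> norm (f z) \<le> 1) \<and> 1 - r (n j) < 1/8"
    by (rule eventually_conj)
  from eventually_happens'[OF sequentially_bot this] obtain j z where close: "\<And>\<zeta>. \<zeta> \<in> K \<Longrightarrow> dist (f (radial_pt w \<zeta> (r (n j)))) 3 < 1"
    and z: "norm (z - of_real (1 - r (n j)) * w) = 1 - (1 - r (n j))" "dist z u < 1/4 \<or> dist z (- u) < 1/4" "norm (f z) \<le> 1"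
    and j: "1 - r (n j) < 1/8"
    by blast
  define k where "k = 1 - r (n j)"
  have k: "0 < k" "k < 1/8" "r (n j) = 1 - k" using j r by (auto simp: k_def radius_seq_def)
  define \<zeta> where "\<zeta> = (z - of_real k * w) / of_real (1 - k)"
  have n\<zeta>: "norm \<zeta> = 1" using z(1) k unfolding \<zeta>_def k_def[symmetric] k(3) norm_divide norm_of_real by simp
  have "of_real (1 - k) * \<zeta> = z - of_real k * w" using k unfolding \<zeta>_def by (auto simp del: of_real_diff)
  then have z\<zeta>: "z = of_real (1 - k) * \<zeta> + of_real k * w" by simp
  then have rad: "radial_pt w \<zeta> (r (n j)) = z" unfolding k(3) by (simp add: algebra_simps)
  have "\<zeta> \<in> K"
  proof -
    have "dist \<zeta> z = norm (of_real k * (\<zeta> - w))" unfolding z\<zeta> dist_norm by (simp add: algebra_simps)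
    also have "\<dots> = k * norm (\<zeta> - w)" using k by (simp add: norm_mult)
    also have "\<dots> \<le> k * 2" using n\<zeta> w k norm_triangle_ineq4[of \<zeta> w] by (intro mult_left_mono) auto
    also have "\<dots> < 1/4" using k by simp
    finally have "dist \<zeta> z < 1/4" .
    then have "dist \<zeta> u < 1/2 \<or> dist \<zeta> (- u) < 1/2"
      using z(2) dist_triangle[of \<zeta> u z] dist_triangle[of \<zeta> "- u" z] by linarith
    moreover have "\<bar>Re (\<zeta> * cnj u) - Re (v * cnj u)\<bar> \<le> dist \<zeta> v" for v
    proof -
      have "norm ((\<zeta> - v) * cnj u) = dist \<zeta> v" using u by (simp add: norm_mult dist_norm)
      then show ?thesis
        using abs_Re_le_cmod[of "(\<zeta> - v) * cnj u"] unfolding left_diff_distrib minus_complex.sel by simp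
    qed
    from this[of u] this[of "- u"] have "\<bar>Re (\<zeta> * cnj u) - 1\<bar> \<le> dist \<zeta> u" "\<bar>Re (\<zeta> * cnj u) + 1\<bar> \<le> dist \<zeta> (- u)"
      unfolding mult_minus_left uu by simp_all
    ultimately show ?thesis using n\<zeta> unfolding K_def by auto
  qed
  from close[OF this] have "dist (f z) 3 < 1" unfolding rad .
  then show False using z(3) norm_triangle_ineq2[of 3 "f z"] by (simp add: dist_norm norm_minus_commute)
qed

lemma exists_abel_universal_wrt_not_abel_universal:
  assumes \<rho>: "radius_seq \<rho>" and w: "norm w\<^sub>1 < 1" "norm w\<^sub>2 < 1" "w\<^sub>1 \<noteq> w\<^sub>2"
  shows "\<exists>f. f \<in> abel_universal_wrt w\<^sub>1 \<rho> \<and> f \<notin> abel_universal w\<^sub>2"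
proof -
  define u where "u = sgn (w\<^sub>1 - w\<^sub>2)"
  have u: "norm u = 1" using w(3) by (simp add: u_def norm_sgn)
  have "d * cnj (sgn d) = of_real (norm d)" for d
    by (cases "d = 0") (auto simp: sgn_eq complex_norm_square[symmetric] power2_eq_square)
  then have "(w\<^sub>1 - w\<^sub>2) * cnj u = of_real (norm (w\<^sub>1 - w\<^sub>2))" by (simp only: u_def)
  then have "Re ((w\<^sub>1 - w\<^sub>2) * cnj u) = norm (w\<^sub>1 - w\<^sub>2)" by simp
  moreover have "0 < norm (w\<^sub>1 - w\<^sub>2)" using w(3) by simp
  ultimately have Rew: "Re (w\<^sub>2 * cnj u) < Re (w\<^sub>1 * cnj u)"
    unfolding left_diff_distrib minus_complex.sel by linarith
  have bd: "\<bar>Re (v * cnj u)\<bar> < 1" if "norm v < 1" for v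
    using abs_Re_le_cmod[of "v * cnj u"] that u by (simp add: norm_mult del: times_complex.sel)
  \<comment> \<open>\<open>\<alpha>\<close> and \<open>\<beta>\<close> are the critical ratios of
    \<open>radial_hits_circle\<close> in the directions \<open>u\<close> and \<open>- u\<close>. As
    \<open>w\<^sub>1 - w\<^sub>2\<close> is a positive multiple of \<open>u\<close>, they lie on
    opposite sides of 1.\<close>
  define \<alpha> where "\<alpha> = (1 - Re (w\<^sub>2 * cnj u)) / (1 - Re (w\<^sub>1 * cnj u))"
  define \<beta> where "\<beta> = (1 - Re (w\<^sub>2 * cnj (- u))) / (1 - Re (w\<^sub>1 * cnj (- u)))"
  have \<alpha>: "1 < \<alpha>" using bd[OF w(1)] Rew unfolding \<alpha>_def by (simp del: times_complex.sel)
  have \<beta>: "0 < \<beta>" "\<beta> < 1"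
    using bd[OF w(1)] bd[OF w(2)] Rew unfolding \<beta>_def by (simp_all del: times_complex.sel)
  \<comment> \<open>The hits will satisfy
    \<open>\<kappa> * k \<le> x \<le> (\<alpha> + 1) * k\<close> and
    \<open>\<beta> / 2 * k \<le> y \<le> k\<close>, so \<open>x / y\<close> lies between
    \<open>\<kappa>\<close> and \<open>\<Lambda>\<close>. \<open>\<eta>\<close> keeps the ratio of
    the ends of a gap below \<open>\<kappa>\<close>, and \<open>\<theta>\<close> is the sparseness
    required by \<open>one_avoids_gaps\<close>.\<close>
  define \<kappa> where "\<kappa> = (1 + \<alpha>) / 2"
  define \<Lambda> where "\<Lambda> = (\<alpha> + 1) / (\<beta> / 2)"
  define \<eta> where "\<eta> = (\<kappa> - 1) / (2 * (\<kappa> + 1))"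
  define \<theta> where "\<theta> = 1 / (\<kappa> * \<Lambda>)"
  have \<kappa>: "1 < \<kappa>" "\<kappa> < \<alpha>" using \<alpha> by (auto simp: \<kappa>_def)
  have \<Lambda>: "1 \<le> \<Lambda>" using \<alpha> \<beta> by (simp add: \<Lambda>_def field_simps)
  have \<theta>: "0 < \<theta>" "\<theta> * \<kappa> * \<Lambda> \<le> 1" using \<kappa> \<Lambda> by (auto simp: \<theta>_def)
  have \<theta>\<kappa>: "\<theta> * \<kappa> \<le> 1" using \<kappa> \<Lambda> by (simp add: \<theta>_def)
  have \<eta>: "0 < \<eta>" "\<eta> < 1" using \<kappa>(1) by (simp_all add: \<eta>_def field_simps)
  have "\<eta> * (\<kappa> + 1) = (\<kappa> - 1) / 2" using \<kappa>(1) by (simp add: \<eta>_def divide_simps)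
  then have \<eta>\<kappa>: "1 + \<eta> < \<kappa> * (1 - \<eta>)" using \<kappa>(1) by (simp add: algebra_simps)
  obtain m where m: "strict_mono m" "\<And>n. 0 < \<rho> (m n)" "\<And>n. 1 - \<rho> (m (Suc n)) \<le> \<theta> * (1 - \<rho> (m n))"
    using radius_seq_sparse[OF \<rho> \<theta>(1)] by blast
  define \<sigma> where "\<sigma> = (\<lambda>n. \<rho> (m n))"
  define h where "h = (\<lambda>n. 1 - \<sigma> n)"
  define \<delta> where "\<delta> n = \<eta> * h n" for n
  have \<sigma>: "0 < \<sigma> n" "\<sigma> n < 1" for n using m(2) \<rho> by (auto simp: \<sigma>_def radius_seq_def)
  have lim\<sigma>: "\<sigma> \<longlonglongrightarrow> 1"
    using \<rho> LIMSEQ_subseq_LIMSEQ[OF _ m(1), of \<rho> 1] by (auto simp: radius_seq_def \<sigma>_def o_def)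
  have h: "0 < h n" "h (Suc n) \<le> \<theta> * h n" for n
    using \<sigma>(2)[of n] m(3)[of n] by (auto simp: h_def \<sigma>_def)
  have limh: "h \<longlonglongrightarrow> 0" unfolding h_def using tendsto_diff[OF tendsto_const[of 1] lim\<sigma>] by simp
  have \<delta>: "0 < \<delta> n" "\<sigma> n + \<delta> n < 1" "\<sigma> n + \<delta> n \<le> \<sigma> (Suc n) - \<delta> (Suc n)" for n
  proof -
    show "0 < \<delta> n" using \<eta> h by (simp add: \<delta>_def)
    have "\<eta> * h n < 1 * h n" using \<eta> h by (intro mult_strict_right_mono) auto
    then show "\<sigma> n + \<delta> n < 1" by (simp add: \<delta>_def h_def)
    \<comment> \<open>Consecutive gaps do not overlap: \<open>\<kappa>\<close> pays for their width,
      and \<open>\<theta> * \<kappa> \<le> 1\<close>.\<close>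
    have "(1 + \<eta>) * h (Suc n) \<le> (\<kappa> * (1 - \<eta>)) * (\<theta> * h n)"
      using \<eta> \<eta>\<kappa> h[of n] h(1)[of "Suc n"] \<kappa> by (intro mult_mono) auto
    also have "\<dots> = (\<theta> * \<kappa>) * ((1 - \<eta>) * h n)" by simp
    also have "\<dots> \<le> 1 * ((1 - \<eta>) * h n)" using \<theta>\<kappa> \<eta> h(1)[of n] by (intro mult_right_mono) auto
    finally show "\<sigma> n + \<delta> n \<le> \<sigma> (Suc n) - \<delta> (Suc n)" by (simp add: \<delta>_def h_def algebra_simps)
  qed
  have uu: "norm (- u) = 1" "u \<noteq> - u" using u by auto
  show ?thesis
  proof (rule universal_bounded_on_segments[OF w(1) u uu \<sigma> lim\<sigma> \<delta>])
    fix f assume hol: "f holomorphic_on ball 0 1"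
      and bounded: "\<And>n c t. c \<in> {u, - u} \<Longrightarrow> t \<in> {\<sigma> n + \<delta> n .. \<sigma> (Suc n) - \<delta> (Suc n)} \<Longrightarrow>
        norm (f (radial_pt w\<^sub>1 c t)) \<le> 1"
      and approx: "\<And>L \<phi> e N. compact L \<Longrightarrow> L \<subset> sphere 0 1 \<Longrightarrow> continuous_on L \<phi> \<Longrightarrow> e > 0 \<Longrightarrow>
        \<exists>n\<ge>N. \<forall>\<zeta>\<in>L. norm (f (radial_pt w\<^sub>1 \<zeta> (\<sigma> n)) - \<phi> \<zeta>) < e"
    have "f \<in> abel_universal_wrt w\<^sub>1 \<rho>"
    proof (rule abel_universal_wrtI[OF hol])
      fix L :: "complex set" and \<phi> :: "complex \<Rightarrow> complex" and e :: real and N :: nat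
      assume "compact L" "L \<subset> sphere 0 1" "continuous_on L \<phi>" "e > 0"
      from approx[OF this, of N] obtain n where "n \<ge> N"
        "\<forall>\<zeta>\<in>L. norm (f (radial_pt w\<^sub>1 \<zeta> (\<sigma> n)) - \<phi> \<zeta>) < e" by blast
      \<comment> \<open>Late indices of \<open>\<sigma>\<close> are late indices of
        \<open>\<rho>\<close>, so approximation along the sparse subsequence suffices.\<close>
      moreover have "n \<le> m n" using m(1) by (rule strict_mono_imp_increasing)
      ultimately show "\<exists>n\<ge>N. \<forall>\<zeta>\<in>L. norm (f (radial_pt w\<^sub>1 \<zeta> (\<rho> n)) - \<phi> \<zeta>) < e"
        by (intro exI[of _ "m n"]) (simp add: \<sigma>_def)
    qed
    moreover have "f \<notin> abel_universal w\<^sub>2"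
    proof (rule not_abel_universal_if_bounded[OF u _ w(2)])
      fix d :: real assume d: "d > 0"
      have "\<forall>\<^sub>F k in at_right 0. \<exists>x\<in>{\<kappa> * k..(\<alpha> + 1) * k}. norm (radial_pt w\<^sub>1 u (1 - x) - of_real k * w\<^sub>2) = 1 - k"
        by (intro radial_hits_circle w u) (fold \<alpha>_def, use \<kappa> in auto)
      moreover have "\<forall>\<^sub>F k in at_right 0. \<exists>y\<in>{\<beta> / 2 * k..1 * k}. norm (radial_pt w\<^sub>1 (- u) (1 - y) - of_real k * w\<^sub>2) = 1 - k"
        by (intro radial_hits_circle w uu) (fold \<beta>_def, use \<beta> in auto)
      \<comment> \<open>Below \<open>k0\<close> the bound \<open>(\<alpha> + 1) * k\<close> on
        \<open>x\<close> is less than \<open>h 0\<close>, where the gaps start, and less than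
        \<open>d / 2\<close>, which keeps both points within \<open>d\<close> of \<open>u\<close> or
        \<open>- u\<close>.\<close>
      moreover define k0 where "k0 = min (h 0) (d / 2) / (\<alpha> + 1)"
      have "k0 > 0" using h d \<alpha> by (simp add: k0_def)
      then have "\<forall>\<^sub>F k::real in at_right 0. 0 < k \<and> k < k0"
        unfolding eventually_at_right_field by (intro exI[of _ k0]) auto
      ultimately show "\<forall>\<^sub>F k::real in at_right 0. \<exists>z. norm (z - of_real k * w\<^sub>2) = 1 - k \<and>
         (dist z u < d \<or> dist z (- u) < d) \<and> norm (f z) \<le> 1"
      proof eventually_elim
        case (elim k)
        obtain x where x: "\<kappa> * k \<le> x" "x \<le> (\<alpha> + 1) * k" "norm (radial_pt w\<^sub>1 u (1 - x) - of_real k * w\<^sub>2) = 1 - k"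
          using elim(1) by auto
        obtain y where y: "\<beta> / 2 * k \<le> y" "y \<le> k" "norm (radial_pt w\<^sub>1 (- u) (1 - y) - of_real k * w\<^sub>2) = 1 - k"
          using elim(2) by auto
        have k: "0 < k" "(\<alpha> + 1) * k < h 0" "(\<alpha> + 1) * k < d / 2"
          using elim(3) \<alpha> by (auto simp: k0_def field_simps)
        have y0: "0 < y" using y(1) \<beta>(1) k(1) mult_pos_pos[of "\<beta> / 2" k] by linarith
        have \<kappa>y: "\<kappa> * y \<le> x" using mult_left_mono[OF y(2), of \<kappa>] \<kappa> x(1) by linarith
        have "\<Lambda> * (\<beta> / 2 * k) \<le> \<Lambda> * y" using y(1) \<Lambda> by (intro mult_left_mono) auto
        moreover have "\<Lambda> * (\<beta> / 2 * k) = (\<alpha> + 1) * k" using \<beta>(1) by (simp add: \<Lambda>_def)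
        ultimately have x\<Lambda>: "x \<le> \<Lambda> * y" using x(2) by linarith
        have yx: "y \<le> x" using \<kappa>y \<kappa>(1) mult_right_mono[of 1 \<kappa> y] y0 by linarith
        have near: "dist (radial_pt w\<^sub>1 c (1 - t)) c < d" if "norm c = 1" "0 < t" "t \<le> x" for c t
        proof -
          have "dist (radial_pt w\<^sub>1 c (1 - t)) c = norm (of_real t * (w\<^sub>1 - c))"
            by (simp add: dist_norm algebra_simps)
          also have "\<dots> = t * norm (w\<^sub>1 - c)" using that by (simp add: norm_mult)
          also have "\<dots> \<le> t * 2"
            using w(1) that norm_triangle_ineq4[of w\<^sub>1 c] by (intro mult_left_mono) auto
          finally show ?thesis using that x(2) k by linarith
        qed
        have "\<exists>n. \<exists>z\<in>{x, y}. z \<in> {(1 + \<eta>) * h (Suc n) .. (1 - \<eta>) * h n}"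
          using x(2) k by (intro one_avoids_gaps[OF h(1) limh h(2) \<theta>(1) \<eta>(1) \<eta>\<kappa> \<kappa>(1) \<Lambda> \<theta>(2) y0 \<kappa>y x\<Lambda>]) auto
        then obtain n t where t: "t \<in> {x, y}" "t \<in> {(1 + \<eta>) * h (Suc n) .. (1 - \<eta>) * h n}" by blast
        \<comment> \<open>Reflection \<open>t \<mapsto> 1 - t\<close> turns the interval between two
          gaps of \<open>h\<close> into radial parameters at which \<open>f\<close> is bounded by
          1.\<close>
        then have t': "1 - t \<in> {\<sigma> n + \<delta> n .. \<sigma> (Suc n) - \<delta> (Suc n)}"
          by (auto simp: \<delta>_def h_def algebra_simps)
        show ?case
        proof (cases "t = x")
          case True
          then show ?thesis
            using x(3) near[of u x] bounded[OF _ t', of u] u y0 yx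
            by (intro exI[of _ "radial_pt w\<^sub>1 u (1 - x)"]) auto
        next
          case False
          then have "t = y" using t(1) by simp
          then show ?thesis
            using y(3) near[of "- u" y] bounded[OF _ t', of "- u"] uu y0 yx
            by (intro exI[of _ "radial_pt w\<^sub>1 (- u) (1 - y)"]) auto
        qed
      qed
    qed
    ultimately show ?thesis by blast
  qed
qed

theorem proposition4p4:
  fixes \<rho>\<^sub>1 \<rho>\<^sub>2 :: "nat \<Rightarrow> real" and w\<^sub>1 w\<^sub>2 :: complex
  assumes "radius_seq \<rho>\<^sub>1" and "radius_seq \<rho>\<^sub>2"
    and "w\<^sub>1 \<in> ball 0 1" and "w\<^sub>2 \<in> ball 0 1" and "w\<^sub>1 \<noteq> w\<^sub>2"
  shows "abel_universal w\<^sub>1 - abel_universal w\<^sub>2 \<noteq> {} \<and>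
         abel_universal_wrt w\<^sub>1 \<rho>\<^sub>1 - abel_universal_wrt w\<^sub>2 \<rho>\<^sub>2 \<noteq> {}"
proof -
  obtain f where "f \<in> abel_universal_wrt w\<^sub>1 \<rho>\<^sub>1" "f \<notin> abel_universal w\<^sub>2"
    using exists_abel_universal_wrt_not_abel_universal[of \<rho>\<^sub>1 w\<^sub>1 w\<^sub>2] assms by auto
  with assms(1,2) have "f \<in> abel_universal w\<^sub>1 - abel_universal w\<^sub>2"
    "f \<in> abel_universal_wrt w\<^sub>1 \<rho>\<^sub>1 - abel_universal_wrt w\<^sub>2 \<rho>\<^sub>2"
    by (auto simp: abel_universal_def)
  then show ?thesis by blast
qed

end
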